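(* Consider the label-noise training setting described in the context and suppose Condition (C) holds. Then, with probability at least $1-O(\delta)$ over the training data and the initialization, there exists $T_1=\Theta\big(\eta^{-1}nm\sigma_\xi^{-2}d^{-1}\big)$ such that $\overline{\rho}^{(T_1)}_{\tilde y_i,r,i}=\Theta(1)$ for all $i\in[n]$ and all $r\in[m]$ with $\langle \mathbf w^{(0)}_{\tilde y_i,r},\boldsymbol\xi_i\rangle\ge 0$, $\gamma^{(T_1)}_{j,r}=\Theta(1)$ for all $j=\pm1$, $r\in[m]$, and 1. $\gamma_{j,r}^{(T_1)}>\overline{\rho}_{\tilde y_i,r,i}^{(T_1)}$ for all $j=\pm1$, $r\in[m]$, $i\in[n]$; 2. every clean sample $i\in\mathcal S_t$ satisfies $\tilde y_i f(\mathbf W^{(T_1)},\mathbf x_i)\ge 0$; 3. every noisy sample $i\in\mathcal S_f$ satisfies $\tilde y_i f(\mathbf W^{(T_1)},\mathbf x_i)\le 0$.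
   Context: Data. Let $d,n,m$ be positive integers, $\boldsymbol\mu\in\mathbb R^d$ a fixed nonzero vector, $\sigma_\xi,\sigma_0,\eta,\epsilon>0$, $\delta\in(0,1)$, $\tau_+,\tau_-\in(0,1/2)$. Training samples $i\in[n]$ are drawn independently: $y_i\in\{\pm1\}$ is the true label with $\mathbb P(y_i=1)=\mathbb P(y_i=-1)=1/2$ (the training set is assumed balanced), $\boldsymbol\xi_i\sim\mathcal N(0,\sigma_\xi^2\mathbf I_d)$, and $\mathbf x_i\in\mathbb R^{2d}$ consists of two patches, one equal to $y_i\boldsymbol\mu$ and the other to $\boldsymbol\xi_i$. The observed label $\tilde y_i$ is obtained by random flipping: $\mathbb P(\tilde y=-1\mid y=1)=\tau_+$, $\mathbb P(\tilde y=1\mid y=-1)=\tau_-$. Clean samples: $\mathcal S_t=\{i:\tilde y_i=y_i\}$; noisy samples: $\mathcal S_f=\{i:\tilde y_i\ne y_i\}$. Network. $\sigma(z)=\max\{0,z\}$, $\sigma'(z)=\mathbf 1(z\ge0)$. For $\mathbf W=\{\mathbf w_{j,r}\in\mathbb R^d\}_{j=\pm1,r\in[m]}$ and an input with signal patch $y\boldsymbol\mu$ and noise patch $\boldsymbol\xi$, $f(\mathbf W,\mathbf x)=F_{+1}-F_{-1}$ with $F_j=\frac1m\sum_{r=1}^m\big(\sigma(\langle\mathbf w_{j,r},y\boldsymbol\mu\rangle)+\sigma(\langle\mathbf w_{j,r},\boldsymbol\xi\rangle)\big)$. Initialization: $\mathbf w_{j,r}^{(0)}\sim\mathcal N(0,\sigma_0^2\mathbf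 I_d)$ independently. Training. Gradient descent $\mathbf w_{j,r}^{(t+1)}=\mathbf w_{j,r}^{(t)}-\eta\nabla_{\mathbf w_{j,r}}L_S(\mathbf W^{(t)})$ on $L_S(\mathbf W)=\frac1n\sum_{i=1}^n\log(1+\exp(-\tilde y_if(\mathbf W,\mathbf x_i)))$. Signal-noise decomposition. $\mathbf w_{j,r}^{(t)}=\mathbf w_{j,r}^{(0)}+j\gamma_{j,r}^{(t)}\|\boldsymbol\mu\|_2^{-2}\boldsymbol\mu+\sum_{i=1}^n\rho_{j,r,i}^{(t)}\|\boldsymbol\xi_i\|_2^{-2}\boldsymbol\xi_i$ (the coefficients are unique since $\boldsymbol\mu,\boldsymbol\xi_1,\dots,\boldsymbol\xi_n$ are almost surely linearly independent), and $\overline\rho^{(t)}_{j,r,i}=\rho^{(t)}_{j,r,i}\mathbf 1(\rho^{(t)}_{j,r,i}\ge0)$, $\underline\rho^{(t)}_{j,r,i}=\rho^{(t)}_{j,r,i}\mathbf 1(\rho^{(t)}_{j,r,i}\le0)$. Notation. $\mathrm{SNR}=\|\boldsymbol\mu\|_2/(\sigma_\xi\sqrt d)$; for given $\epsilon>0$, $T^*=\widetilde\Theta(\eta^{-1}\epsilon^{-1}nm\sigma_\xi^{-2}d^{-1})$ is the maximum number of iterations. $O,\Omega,\Theta$ hide positive constants, and tildes additionally hide logarithmic factors. Condition (C). There is a sufficiently large constant $C$ such that: (1) $n\cdot\mathrm{SNR}^2=\Theta(1)$, $\tau_+,\tau_-=\Theta(1)$; (2) $d\ge C\max\{n^2\log(nm/\delta)\log(T^*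 )^2,\ n\|\boldsymbol\mu\|_2\sigma_\xi^{-1}\sqrt{\log(n/\delta)}\}$; (3) $m\ge C\log(n/\delta)$, $n\ge C\log(m/\delta)$; (4) $\|\boldsymbol\mu\|_2^2\ge C\sigma_\xi^2\log(n/\delta)$; (5) $\sigma_0\le C^{-1}\min\{\sqrt n\,\sigma_\xi^{-1}d^{-1},\ \|\boldsymbol\mu\|_2^{-1}\log(m/\delta)^{-1/2}\}$; (6) $0<\eta\le C^{-1}\min\{\sigma_\xi^{-2}d^{-3/2}n^2m\sqrt{\log(n/\delta)},\ \sigma_\xi^{-2}d^{-1}n\}$.
   Formalization: n·SNR²=Θ(1) is read with a sufficiently large lower constant (depending on the bound τ₊,τ₋≤τ₁<1/2), since for small n·SNR²(1−2τ) the claim γ>ρ̄ fails; ε is at most an arbitrary fixed ε₀ on which C may depend, so T* is not degenerate. *)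

theory Defs
  imports "HOL-Probability.Probability"
begin

text \<open>
  The dimension \<open>d\<close>, the sample size \<open>n\<close> and the width \<open>m\<close> vary under the quantifiers that bind
  the hidden constants, so a vector of dimension \<open>d\<close> is a function \<open>nat \<Rightarrow> real\<close> of which only the
  entries below \<open>d\<close> matter.  Samples and neurons are numbered from \<open>0\<close>; the output index \<open>j\<close> and
  the labels are the integers \<open>1\<close> and \<open>-1\<close>.
\<close>

type_synonym rvec = "nat \<Rightarrow> real"
type_synonym weights = "int \<Rightarrow> nat \<Rightarrow> rvec"

definition dotp :: "nat \<Rightarrow> rvec \<Rightarrow> rvec \<Rightarrow> real" where
  "dotp d u v = (\<Sum>k<d. u k * v k)"

abbreviation vnorm :: "nat \<Rightarrow> rvec \<Rightarrow> real" where
  "vnorm d v \<equiv> L2_set v {..<d}"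

record setting =
  dm :: nat          \<comment> \<open>\<open>d\<close>\<close>
  ns :: nat          \<comment> \<open>\<open>n\<close>\<close>
  wd :: nat          \<comment> \<open>\<open>m\<close>\<close>
  sig :: rvec        \<comment> \<open>\<open>\<mu>\<close>\<close>
  sd_noise :: real   \<comment> \<open>\<open>\<sigma>\<^sub>\<xi>\<close>\<close>
  sd_init :: real    \<comment> \<open>\<open>\<sigma>\<^sub>0\<close>\<close>
  lrate :: real      \<comment> \<open>\<open>\<eta>\<close>\<close>
  acc :: real        \<comment> \<open>\<open>\<epsilon>\<close>\<close>
  conf :: real       \<comment> \<open>\<open>\<delta>\<close>\<close>
  flip_pos :: real   \<comment> \<open>\<open>\<tau>\<^sub>+\<close>\<close>
  flip_neg :: real   \<comment> \<open>\<open>\<tau>\<^sub>-\<close>\<close>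
  horizon :: nat     \<comment> \<open>\<open>T\<^sup>*\<close>, tied to the other parameters in \<open>condition_C\<close>\<close>

definition well_posed :: "setting \<Rightarrow> bool" where
  "well_posed P \<longleftrightarrow>
     dm P > 0 \<and> ns P > 0 \<and> wd P > 0 \<and> (\<exists>k<dm P. sig P k \<noteq> 0) \<and>
     sd_noise P > 0 \<and> sd_init P > 0 \<and> lrate P > 0 \<and> acc P > 0 \<and>
     0 < conf P \<and> conf P < 1 \<and>
     0 < flip_pos P \<and> flip_pos P < 1/2 \<and> 0 < flip_neg P \<and> flip_neg P < 1/2"


section \<open>Network, loss and gradient descent\<close>

definition relu :: "real \<Rightarrow> real" where
  "relu z = max 0 z"

definition relu' :: "real \<Rightarrow> real" where
  "relu' z = of_bool (z \<ge> 0)"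

text \<open>An input is the pair of its two patches; their order is irrelevant to the network.\<close>

definition F_out :: "nat \<Rightarrow> nat \<Rightarrow> weights \<Rightarrow> int \<Rightarrow> rvec \<times> rvec \<Rightarrow> real" where
  "F_out d m W j x =
     1 / real m * (\<Sum>r<m. relu (dotp d (W j r) (fst x)) + relu (dotp d (W j r) (snd x)))"

definition net :: "nat \<Rightarrow> nat \<Rightarrow> weights \<Rightarrow> rvec \<times> rvec \<Rightarrow> real" where
  "net d m W x = F_out d m W 1 x - F_out d m W (-1) x"

definition train_loss ::
  "nat \<Rightarrow> nat \<Rightarrow> nat \<Rightarrow> (nat \<Rightarrow> rvec \<times> rvec) \<Rightarrow> (nat \<Rightarrow> int) \<Rightarrow> weights \<Rightarrow> real" where
  "train_loss d n m x y W =
     1 / real n * (\<Sum>i<n. ln (1 + exp (- (of_int (y i) * net d m W (x i)))))"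

text \<open>
  The gradient of \<open>train_loss\<close> with respect to the weight vector \<open>(j, r)\<close>, computed by the chain
  rule with the convention \<open>relu'\<close> for the derivative of \<open>relu\<close>; the factor \<open>-1 / (1 + exp z)\<close> is
  the derivative of \<open>ln (1 + exp (-z))\<close>.  Lemma \<open>train_loss_derivative\<close> confirms that it is the
  true gradient wherever no neuron sits at the kink of \<open>relu\<close>.
\<close>

definition loss_grad ::
  "nat \<Rightarrow> nat \<Rightarrow> nat \<Rightarrow> (nat \<Rightarrow> rvec \<times> rvec) \<Rightarrow> (nat \<Rightarrow> int) \<Rightarrow> weights \<Rightarrow> int \<Rightarrow> nat \<Rightarrow> rvec" where
  "loss_grad d n m x y W j r k =
     1 / real n * (\<Sum>i<n. - 1 / (1 + exp (of_int (y i) * net d m W (x i))) * of_int (y i) *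
       (of_int j / real m *
         (relu' (dotp d (W j r) (fst (x i))) * fst (x i) k +
          relu' (dotp d (W j r) (snd (x i))) * snd (x i) k)))"

primrec gd ::
  "real \<Rightarrow> nat \<Rightarrow> nat \<Rightarrow> nat \<Rightarrow> (nat \<Rightarrow> rvec \<times> rvec) \<Rightarrow> (nat \<Rightarrow> int) \<Rightarrow> weights \<Rightarrow> nat \<Rightarrow> weights" where
  "gd \<eta> d n m x y W0 0 = W0"
| "gd \<eta> d n m x y W0 (Suc t) =
     (\<lambda>j r k. gd \<eta> d n m x y W0 t j r k - \<eta> * loss_grad d n m x y (gd \<eta> d n m x y W0 t) j r k)"

lemma dotp_upd:
  assumes "k < d"
  shows "dotp d (u(k := v)) p = dotp d u p + (v - u k) * p k"
proof -
  have "(\<Sum>l<d. (u(k := v)) l * p l) = (\<Sum>l<d. u l * p l + (if l = k then (v - u k) * p k else 0))"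
    by (intro sum.cong) (auto simp: algebra_simps)
  then show ?thesis
    using assms by (simp add: dotp_def sum.distrib)
qed

lemma relu_dotp_derivative:
  assumes "k < d" and "dotp d u p \<noteq> 0"
  shows "((\<lambda>v. relu (dotp d (u(k := v)) p)) has_real_derivative relu' (dotp d u p) * p k) (at (u k))"
proof -
  have D: "((\<lambda>v. dotp d (u(k := v)) p) has_real_derivative p k) (at (u k))"
    unfolding dotp_upd[OF assms(1)] by (auto intro!: derivative_eq_intros)
  then have "isCont (\<lambda>v. dotp d (u(k := v)) p) (u k)"
    by (rule DERIV_isCont)
  then have lim: "((\<lambda>v. dotp d (u(k := v)) p) \<longlongrightarrow> dotp d u p) (nhds (u k))"
    using tendsto_at_iff_tendsto_nhds[of "\<lambda>v. dotp d (u(k := v)) p" "u k"]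
    by (simp add: isCont_def)
  show ?thesis
  proof (cases "dotp d u p > 0")
    case True
    then have "eventually (\<lambda>v. dotp d (u(k := v)) p > 0) (nhds (u k))"
      using lim by (rule order_tendstoD(1)[rotated])
    then have "eventually (\<lambda>v. relu (dotp d (u(k := v)) p) = dotp d (u(k := v)) p) (nhds (u k))"
      by eventually_elim (simp add: relu_def)
    moreover have "relu' (dotp d u p) = 1"
      using True by (simp add: relu'_def)
    ultimately show ?thesis
      using D by (simp add: DERIV_cong_ev)
  next
    case False
    then have neg: "dotp d u p < 0"
      using assms(2) by simp
    then have "eventually (\<lambda>v. dotp d (u(k := v)) p < 0) (nhds (u k))"
      using lim by (rule order_tendstoD(2)[rotated])
    then have "eventually (\<lambda>v. relu (dotp d (u(k := v)) p) = 0) (nhds (u k))"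
      by eventually_elim (simp add: relu_def)
    moreover have "relu' (dotp d u p) = 0"
      using neg by (simp add: relu'_def)
    ultimately show ?thesis
      by (simp add: DERIV_cong_ev)
  qed
qed

lemma F_out_derivative:
  assumes "k < d" "r < m" "dotp d (W j r) (fst x) \<noteq> 0" "dotp d (W j r) (snd x) \<noteq> 0"
  shows "((\<lambda>v. F_out d m (W(j := (W j)(r := (W j r)(k := v)))) j' x) has_real_derivative
           of_bool (j' = j) / real m *
             (relu' (dotp d (W j r) (fst x)) * fst x k + relu' (dotp d (W j r) (snd x)) * snd x k))
         (at (W j r k))" (is "(_ has_real_derivative _ / _ * ?G) _")
proof (cases "j' = j")
  case True
  have "((\<lambda>v. \<Sum>s<m. relu (dotp d ((W(j := (W j)(r := (W j r)(k := v)))) j s) (fst x)) +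
                      relu (dotp d ((W(j := (W j)(r := (W j r)(k := v)))) j s) (snd x)))
          has_real_derivative (\<Sum>s<m. if s = r then ?G else 0)) (at (W j r k))"
  proof (rule DERIV_sum)
    fix s
    show "((\<lambda>v. relu (dotp d ((W(j := (W j)(r := (W j r)(k := v)))) j s) (fst x)) +
                relu (dotp d ((W(j := (W j)(r := (W j r)(k := v)))) j s) (snd x)))
          has_real_derivative (if s = r then ?G else 0)) (at (W j r k))"
      using relu_dotp_derivative[OF assms(1) assms(3)] relu_dotp_derivative[OF assms(1) assms(4)]
      by (cases "s = r") (auto intro: DERIV_add)
  qed
  then have "((\<lambda>v. F_out d m (W(j := (W j)(r := (W j r)(k := v)))) j x) has_real_derivative
                1 / real m * (\<Sum>s<m. if s = r then ?G else 0)) (at (W j r k))"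
    unfolding F_out_def by (rule DERIV_cmult)
  then show ?thesis
    using True assms(2) by simp
next
  case False
  then show ?thesis
    by (simp add: F_out_def)
qed

lemma train_loss_derivative:
  assumes j: "j \<in> {1, -1}" and r: "r < m" and k: "k < d"
    and kink: "\<And>i. i < n \<Longrightarrow> dotp d (W j r) (fst (x i)) \<noteq> 0 \<and> dotp d (W j r) (snd (x i)) \<noteq> 0"
  shows "((\<lambda>v. train_loss d n m x y (W(j := (W j)(r := (W j r)(k := v))))) has_real_derivative
           loss_grad d n m x y W j r k) (at (W j r k))"
proof -
  define V where "V v = W(j := (W j)(r := (W j r)(k := v)))" for v
  define G where "G i = of_int j / real m *
    (relu' (dotp d (W j r) (fst (x i))) * fst (x i) k +
     relu' (dotp d (W j r) (snd (x i))) * snd (x i) k)" for i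
  have V0: "V (W j r k) = W"
    by (simp add: V_def)
  have N: "((\<lambda>v. net d m (V v) (x i)) has_real_derivative G i) (at (W j r k))" if "i < n" for i
    using DERIV_diff[OF F_out_derivative[of k d r m W j "x i" 1] F_out_derivative[of k d r m W j "x i" "-1"]]
      kink[OF that] j r k
    by (auto simp: net_def V_def G_def add_divide_distrib diff_divide_distrib)
  have L: "((\<lambda>v. ln (1 + exp (- (of_int (y i) * net d m (V v) (x i))))) has_real_derivative
          - 1 / (1 + exp (of_int (y i) * net d m W (x i))) * of_int (y i) * G i) (at (W j r k))"
    if "i < n" for i
  proof -
    have pos: "1 + exp z > (0::real)" for z
      by (simp add: add_pos_pos)
    have e: "exp (- z) / (1 + exp (- z)) = 1 / (1 + exp z)" for z :: real
      using pos[of z] by (simp add: exp_minus field_simps)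
    have "((\<lambda>v. ln (1 + exp (- (of_int (y i) * net d m (V v) (x i))))) has_real_derivative
          - (exp (- (of_int (y i) * net d m W (x i))) / (1 + exp (- (of_int (y i) * net d m W (x i)))))
            * of_int (y i) * G i) (at (W j r k))"
      using pos by (auto intro!: derivative_eq_intros N[OF that] simp: V0 divide_simps)
    then show ?thesis
      unfolding e by simp
  qed
  have "((\<lambda>v. train_loss d n m x y (V v)) has_real_derivative
      1 / real n * (\<Sum>i<n. - 1 / (1 + exp (of_int (y i) * net d m W (x i))) * of_int (y i) * G i))
    (at (W j r k))"
    unfolding train_loss_def by (intro DERIV_cmult DERIV_sum L) simp
  then show ?thesis
    by (simp add: V_def G_def loss_grad_def)
qed


section \<open>Law of the training data and of the initialization\<close>

text \<open>\<open>N(0, s\<^sup>2 I\<^sub>d)\<close>: independent coordinates, each \<open>N(0, s\<^sup>2)\<close>.\<close>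

definition gauss_vec :: "nat \<Rightarrow> real \<Rightarrow> rvec measure" where
  "gauss_vec d s = PiM {..<d} (\<lambda>_. density lborel (normal_density 0 s))"

text \<open>
  The joint law of the true label and the observed label.  Balance of the training set is the
  uniform law of the true label; the class counts of a sample remain random.
\<close>

definition label_pmf :: "real \<Rightarrow> real \<Rightarrow> (int \<times> int) pmf" where
  "label_pmf \<tau>p \<tau>m =
     do { y \<leftarrow> pmf_of_set {1, -1};
          flipped \<leftarrow> bernoulli_pmf (if y = 1 then \<tau>p else \<tau>m);
          return_pmf (y, if flipped then - y else y) }"

text \<open>
  An outcome consists of the sequence of samples, the \<open>i\<close>-th being
  \<open>((true label, observed label), noise vector)\<close>, and of the initial weights indexed by \<open>(j, r)\<close>.
\<close>

type_synonym outcome = "(nat \<Rightarrow> (int \<times> int) \<times> rvec) \<times> (int \<times> nat \<Rightarrow> rvec)"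

definition training_law :: "setting \<Rightarrow> outcome measure" where
  "training_law P =
     PiM {..<ns P} (\<lambda>_. measure_pmf (label_pmf (flip_pos P) (flip_neg P)) \<Otimes>\<^sub>M
                         gauss_vec (dm P) (sd_noise P))
     \<Otimes>\<^sub>M PiM ({1, -1} \<times> {..<wd P}) (\<lambda>_. gauss_vec (dm P) (sd_init P))"

definition true_label :: "outcome \<Rightarrow> nat \<Rightarrow> int" where
  "true_label \<omega> i = fst (fst (fst \<omega> i))"

definition obs_label :: "outcome \<Rightarrow> nat \<Rightarrow> int" where
  "obs_label \<omega> i = snd (fst (fst \<omega> i))"

definition noise :: "outcome \<Rightarrow> nat \<Rightarrow> rvec" where
  "noise \<omega> i = snd (fst \<omega> i)"

definition init_weights :: "outcome \<Rightarrow> weights" where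
  "init_weights \<omega> j r = snd \<omega> (j, r)"

definition sample :: "setting \<Rightarrow> outcome \<Rightarrow> nat \<Rightarrow> rvec \<times> rvec" where
  "sample P \<omega> i = ((\<lambda>k. of_int (true_label \<omega> i) * sig P k), noise \<omega> i)"

definition clean_samples :: "setting \<Rightarrow> outcome \<Rightarrow> nat set" where
  "clean_samples P \<omega> = {i. i < ns P \<and> obs_label \<omega> i = true_label \<omega> i}"

definition noisy_samples :: "setting \<Rightarrow> outcome \<Rightarrow> nat set" where
  "noisy_samples P \<omega> = {i. i < ns P \<and> obs_label \<omega> i \<noteq> true_label \<omega> i}"

definition iterate :: "setting \<Rightarrow> outcome \<Rightarrow> nat \<Rightarrow> weights" where
  "iterate P \<omega> t =
     gd (lrate P) (dm P) (ns P) (wd P) (sample P \<omega>) (obs_label \<omega>) (init_weights \<omega>) t"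

definition net_at :: "setting \<Rightarrow> outcome \<Rightarrow> nat \<Rightarrow> nat \<Rightarrow> real" where
  "net_at P \<omega> t i = net (dm P) (wd P) (iterate P \<omega> t) (sample P \<omega> i)"


section \<open>Signal-noise decomposition\<close>

text \<open>
  The entries \<open>\<rho> i\<close> with \<open>i \<ge> n\<close> carry no information and are normalized to \<open>0\<close>, so that
  uniqueness of the coefficients is uniqueness of the pair \<open>(\<gamma>, \<rho>)\<close>.  Uniqueness holds almost surely
  when \<open>n < d\<close>; the value of \<open>decomp_coeffs\<close> is unspecified where it fails.
\<close>

definition is_decomp ::
  "setting \<Rightarrow> outcome \<Rightarrow> nat \<Rightarrow> int \<Rightarrow> nat \<Rightarrow> real \<times> (nat \<Rightarrow> real) \<Rightarrow> bool" where
  "is_decomp P \<omega> t j r c \<longleftrightarrow>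
     (\<forall>k<dm P. iterate P \<omega> t j r k =
        init_weights \<omega> j r k
        + of_int j * fst c * sig P k / (vnorm (dm P) (sig P))\<^sup>2
        + (\<Sum>i<ns P. snd c i * noise \<omega> i k / (vnorm (dm P) (noise \<omega> i))\<^sup>2)) \<and>
     (\<forall>i\<ge>ns P. snd c i = 0)"

definition decomp_coeffs :: "setting \<Rightarrow> outcome \<Rightarrow> nat \<Rightarrow> int \<Rightarrow> nat \<Rightarrow> real \<times> (nat \<Rightarrow> real)" where
  "decomp_coeffs P \<omega> t j r = (THE c. is_decomp P \<omega> t j r c)"

definition gam :: "setting \<Rightarrow> outcome \<Rightarrow> nat \<Rightarrow> int \<Rightarrow> nat \<Rightarrow> real" where
  "gam P \<omega> t j r = fst (decomp_coeffs P \<omega> t j r)"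

definition rho :: "setting \<Rightarrow> outcome \<Rightarrow> nat \<Rightarrow> int \<Rightarrow> nat \<Rightarrow> nat \<Rightarrow> real" where
  "rho P \<omega> t j r i = snd (decomp_coeffs P \<omega> t j r) i"

definition rho_bar :: "setting \<Rightarrow> outcome \<Rightarrow> nat \<Rightarrow> int \<Rightarrow> nat \<Rightarrow> nat \<Rightarrow> real" where
  "rho_bar P \<omega> t j r i = rho P \<omega> t j r i * of_bool (rho P \<omega> t j r i \<ge> 0)"


section \<open>The condition on the parameters\<close>

definition SNR :: "setting \<Rightarrow> real" where
  "SNR P = vnorm (dm P) (sig P) / (sd_noise P * sqrt (real (dm P)))"

definition time_unit :: "setting \<Rightarrow> real" where
  "time_unit P = real (ns P) * real (wd P) / (lrate P * (sd_noise P)\<^sup>2 * real (dm P))"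

text \<open>\<open>f = \<Theta>(g)\<close> up to a power of \<open>log g\<close>, with explicit constants; the \<open>exp 1\<close> keeps the logarithm at least \<open>1\<close>.\<close>

definition soft_Theta :: "real \<Rightarrow> real \<Rightarrow> nat \<Rightarrow> real \<Rightarrow> real \<Rightarrow> bool" where
  "soft_Theta a1 a2 p f g \<longleftrightarrow>
     a1 * g / ln (exp 1 + g) ^ p \<le> f \<and> f \<le> a2 * g * ln (exp 1 + g) ^ p"

definition horizon_ok :: "real \<Rightarrow> real \<Rightarrow> nat \<Rightarrow> setting \<Rightarrow> bool" where
  "horizon_ok a1 a2 p P \<longleftrightarrow> soft_Theta a1 a2 p (real (horizon P)) (time_unit P / acc P)"

text \<open>
  \<open>\<kappa>0\<close>, \<open>\<kappa>1\<close> and \<open>\<tau>0\<close>, \<open>\<tau>1\<close> are the constants hidden in \<open>n SNR\<^sup>2 = \<Theta>(1)\<close> and in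
  \<open>\<tau>\<^sub>+, \<tau>\<^sub>- = \<Theta>(1)\<close>.  They cannot all be arbitrary: in early training \<open>\<gamma>\<close> grows about
  \<open>n SNR\<^sup>2 (1 - 2 \<tau>) / 2\<close> times as fast as \<open>\<rho>\<close>, so \<open>\<gamma> > \<rho>\<close> requires \<open>\<tau>1 < 1/2\<close> and a
  lower bound \<open>\<kappa>0\<close> that is large enough in terms of \<open>\<tau>1\<close>.
\<close>

definition condition_C :: "real \<Rightarrow> real \<Rightarrow> real \<Rightarrow> real \<Rightarrow> real \<Rightarrow> setting \<Rightarrow> bool" where
  "condition_C \<kappa>0 \<kappa>1 \<tau>0 \<tau>1 C P \<longleftrightarrow>
     (let d = real (dm P); n = real (ns P); m = real (wd P); \<mu> = vnorm (dm P) (sig P);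
          \<sigma>\<xi> = sd_noise P; \<sigma>0 = sd_init P; \<eta> = lrate P; \<delta> = conf P; T = real (horizon P)
      in
        \<kappa>0 \<le> n * (SNR P)\<^sup>2 \<and> n * (SNR P)\<^sup>2 \<le> \<kappa>1 \<and>
        flip_pos P \<in> {\<tau>0..\<tau>1} \<and> flip_neg P \<in> {\<tau>0..\<tau>1} \<and>
        d \<ge> C * max (n\<^sup>2 * ln (n * m / \<delta>) * (ln T)\<^sup>2) (n * \<mu> / \<sigma>\<xi> * sqrt (ln (n / \<delta>))) \<and>
        m \<ge> C * ln (n / \<delta>) \<and> n \<ge> C * ln (m / \<delta>) \<and>
        \<mu>\<^sup>2 \<ge> C * \<sigma>\<xi>\<^sup>2 * ln (n / \<delta>) \<and>
        \<sigma>0 \<le> 1 / C * min (sqrt n / (\<sigma>\<xi> * d)) (1 / (\<mu> * sqrt (ln (m / \<delta>)))) \<and>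
        \<eta> \<le> 1 / C * min (n\<^sup>2 * m * sqrt (ln (n / \<delta>)) / (\<sigma>\<xi>\<^sup>2 * d powr (3/2))) (n / (\<sigma>\<xi>\<^sup>2 * d)))"

end

theory Submission
  imports Defs
begin

text \<open>
  With high probability the noise vectors have norm about \<open>\<sigma>\<^sub>\<xi> \<surd>d\<close>, they are nearly orthogonal to each
  other and to \<open>\<mu>\<close>, all initial preactivations are tiny, and among the samples of either true label
  the clean ones outnumber the noisy ones by a fixed fraction of \<open>n\<close>.  Let \<open>h = 1 / time_unit\<close>.  As long
  as \<open>t h \<le> c\<close> for a small constant \<open>c\<close>, the trivial bounds \<open>|\<gamma>| \<le> \<kappa>1 t h\<close> and \<open>|\<rho>| \<le> 2 t h\<close> keep
  the network output small, so every loss derivative stays close to \<open>1/2\<close>.  Hence, whatever the sign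
  of \<open>\<langle>w, \<mu>\<rangle>\<close>, each step increases \<open>\<gamma>\<close> by a multiple of \<open>n SNR\<^sup>2 h\<close>, and for \<open>\<kappa>0\<close> large this gives
  \<open>\<gamma> \<ge> 3 t h > \<rho>\<close>.  A neuron that is active on its noise vector at the start remains active, since the
  cross terms are dominated by the growth of \<open>\<rho>\<close>.  At \<open>t h \<approx> c\<close> the signal learned by the neurons of
  the true label therefore outweighs everything that the other neurons have memorized.
\<close>

section \<open>Chernoff bounds for products and Gaussian vectors\<close>

text \<open>The obstacle is a circle: bounding the coefficients needs the network outputs, which
  need the coefficients. It is broken by a bound that uses only that loss derivatives have modulus
  at most 1, so there is no stopping time and no joint induction. The constants come from
  \<open>p = (1 - 2 * \<tau>1) / 4\<close>. The surplus of clean samples in a class has mean at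
  least \<open>2 * n * p\<close>, of which \<open>n * p\<close> survives with high probability.
  Outputs of size \<open>p / 2\<close> move each derivative by at most \<open>p / 4\<close>, so the
  sum that drives \<gamma> keeps \<open>n * p / 4\<close>, and \<kappa>0 = \<open>12 / p\<close>
  turns this into growth \<open>3 * h\<close> per step. The 3 must beat the 2 in the bound on
  \<rho>, since squared noise norms are bounded only by twice their mean; the remaining
  \<open>t * h\<close> pays for initialization and cross terms, so training must also last a fixed
  fraction of the allowed time. A second obstacle is the squared logarithm of the horizon in the
  bound on d: it helps only once the horizon is large, which follows from the bound on the learning
  rate together with \<open>acc P \<le> \<epsilon>0\<close>.\<close>

lemma distr_PiM_pair:
  assumes M: "\<And>i. i \<in> I \<Longrightarrow> prob_space (M i)" and ij: "i \<in> I" "j \<in> I" "i \<noteq> j"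
  shows "distr (PiM I M) (M i \<Otimes>\<^sub>M M j) (\<lambda>\<omega>. (\<omega> i, \<omega> j)) = M i \<Otimes>\<^sub>M M j"
proof (rule pair_measure_eqI[symmetric])
  interpret Mi: prob_space "M i" using M ij by simp
  interpret Mj: prob_space "M j" using M ij by simp
  show "sigma_finite_measure (M i)" "sigma_finite_measure (M j)" ..
  fix A B assume A: "A \<in> sets (M i)" and B: "B \<in> sets (M j)"
  define F where "F k = (if k = i then A else B)" for k
  \<comment> \<open>A rectangle pulls back to a cylinder over two distinct coordinates, whose
    measure is a product. This is the independence of two samples.\<close>
  have "(\<lambda>\<omega>. (\<omega> i, \<omega> j)) -` (A \<times> B) \<inter> space (PiM I M) = prod_emb I M {i, j} (Pi\<^sub>E {i, j} F)"
    using ij by (auto simp: prod_emb_def space_PiM F_def PiE_iff)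
  then have "emeasure (distr (PiM I M) (M i \<Otimes>\<^sub>M M j) (\<lambda>\<omega>. (\<omega> i, \<omega> j))) (A \<times> B)
      = emeasure (PiM I M) (prod_emb I M {i, j} (Pi\<^sub>E {i, j} F))"
    using A B ij by (subst emeasure_distr) auto
  also have "\<dots> = (\<Prod>k\<in>{i, j}. emeasure (M k) (F k))"
    using A B ij by (intro emeasure_PiM_emb M) (auto simp: F_def)
  also have "\<dots> = emeasure (M i) A * emeasure (M j) B"
    using ij by (auto simp: F_def)
  finally show "emeasure (M i) A * emeasure (M j) B =
    emeasure (distr (PiM I M) (M i \<Otimes>\<^sub>M M j) (\<lambda>\<omega>. (\<omega> i, \<omega> j))) (A \<times> B)" ..
qed simp

text \<open>Markov's inequality for the exponential of the sum; the product law factorises the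
  exponential moment. Working with \<open>nn_integral\<close> avoids integrability conditions, and a
  tilt parameter is absorbed into \<open>f\<close>.\<close>

lemma emeasure_PiM_Chernoff:
  assumes I: "finite I" and M: "\<And>i. i \<in> I \<Longrightarrow> prob_space (M i)"
    and f [measurable]: "\<And>i. i \<in> I \<Longrightarrow> f i \<in> borel_measurable (M i)"
    and mgf: "\<And>i. i \<in> I \<Longrightarrow> (\<integral>\<^sup>+x. ennreal (exp (f i x)) \<partial>M i) \<le> ennreal (exp (c i))"
  shows "emeasure (PiM I M) {\<omega> \<in> space (PiM I M). t \<le> (\<Sum>i\<in>I. f i (\<omega> i))}
    \<le> ennreal (exp ((\<Sum>i\<in>I. c i) - t))"
proof -
  \<comment> \<open>\<open>product_prob_space\<close> wants a probability space at every index, so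
    the family is completed by a Dirac measure outside \<open>I\<close>.\<close>
  define M' where "M' i = (if i \<in> I then M i else return (count_space UNIV) undefined)" for i
  interpret product_prob_space M'
    by (rule product_prob_spaceI) (auto simp: M'_def M intro!: prob_space_return)
  have eq: "PiM I M = PiM I M'"
    by (intro PiM_cong) (auto simp: M'_def)
  have f' [measurable]: "f i \<in> borel_measurable (M' i)" if "i \<in> I" for i
    using f that by (simp add: M'_def)
  have [measurable]: "(\<lambda>\<omega>. f i (\<omega> i)) \<in> borel_measurable (PiM I M')" if "i \<in> I" for i
    using that by measurable
  let ?S = "\<lambda>\<omega>. \<Sum>i\<in>I. f i (\<omega> i)"
  have "{\<omega> \<in> space (PiM I M'). t \<le> ?S \<omega>} =
      {\<omega> \<in> space (PiM I M'). 1 \<le> ennreal (exp (-t)) * ennreal (exp (?S \<omega>))}"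
    by (auto simp: ennreal_mult[symmetric] exp_add[symmetric])
  also have "emeasure (PiM I M') \<dots> \<le>
      ennreal (exp (-t)) * (\<integral>\<^sup>+\<omega>. ennreal (exp (?S \<omega>)) * indicator (space (PiM I M')) \<omega> \<partial>PiM I M')"
    by (intro nn_integral_Markov_inequality) auto
  also have "(\<integral>\<^sup>+\<omega>. ennreal (exp (?S \<omega>)) * indicator (space (PiM I M')) \<omega> \<partial>PiM I M')
      = (\<integral>\<^sup>+\<omega>. (\<Prod>i\<in>I. ennreal (exp (f i (\<omega> i)))) \<partial>PiM I M')"
    using I by (intro nn_integral_cong) (simp add: exp_sum prod_ennreal)
  also have "\<dots> = (\<Prod>i\<in>I. \<integral>\<^sup>+x. ennreal (exp (f i x)) \<partial>M' i)"
    using I by (intro product_nn_integral_prod) auto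
  also have "\<dots> \<le> (\<Prod>i\<in>I. ennreal (exp (c i)))"
    using mgf by (intro prod_mono_ennreal) (auto simp: M'_def)
  also have "\<dots> = ennreal (exp (\<Sum>i\<in>I. c i))"
    using I by (simp add: exp_sum prod_ennreal)
  also have "ennreal (exp (-t)) * \<dots> = ennreal (exp ((\<Sum>i\<in>I. c i) - t))"
    by (simp add: ennreal_mult[symmetric] exp_add[symmetric])
  finally show ?thesis
    by (simp add: eq mult_left_mono)
qed

section \<open>Exponential moments of the normal distribution\<close>

lemma normal_density_mult_exp_linear:
  assumes "s > 0"
  shows "normal_density 0 s x * exp (a * x) = exp (a\<^sup>2 * s\<^sup>2 / 2) * normal_density (a * s\<^sup>2) s x"
proof -
  \<comment> \<open>Completing the square: an exponential tilt is a shift of the mean by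
    \<open>a * s\<^sup>2\<close>.\<close>
  have "- x\<^sup>2 / (2 * s\<^sup>2) + a * x = a\<^sup>2 * s\<^sup>2 / 2 - (x - a * s\<^sup>2)\<^sup>2 / (2 * s\<^sup>2)"
    using assms by (simp add: field_simps power2_eq_square)
  then have "exp (- x\<^sup>2 / (2 * s\<^sup>2)) * exp (a * x) = exp (a\<^sup>2 * s\<^sup>2 / 2) * exp (- (x - a * s\<^sup>2)\<^sup>2 / (2 * s\<^sup>2))"
    by (simp add: exp_add[symmetric])
  then show ?thesis
    by (simp add: normal_density_def)
qed

lemma nn_integral_normal_exp_linear:
  assumes "s > 0"
  shows "(\<integral>\<^sup>+x. ennreal (exp (a * x)) \<partial>density lborel (normal_density 0 s)) = ennreal (exp (a\<^sup>2 * s\<^sup>2 / 2))"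
proof -
  interpret N: prob_space "density lborel (normal_density (a * s\<^sup>2) s)"
    using assms by (rule prob_space_normal_density)
  have "(\<integral>\<^sup>+x. ennreal (exp (a * x)) \<partial>density lborel (normal_density 0 s))
      = (\<integral>\<^sup>+x. ennreal (exp (a\<^sup>2 * s\<^sup>2 / 2)) * ennreal (normal_density (a * s\<^sup>2) s x) \<partial>lborel)"
    by (subst nn_integral_density)
      (auto simp: ennreal_mult[symmetric] normal_density_mult_exp_linear[OF assms] intro!: nn_integral_cong)
  also have "\<dots> = ennreal (exp (a\<^sup>2 * s\<^sup>2 / 2)) * (\<integral>\<^sup>+x. ennreal (normal_density (a * s\<^sup>2) s x) \<partial>lborel)"
    by (rule nn_integral_cmult) simp
  also have "(\<integral>\<^sup>+x. ennreal (normal_density (a * s\<^sup>2) s x) \<partial>lborel) = 1"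
    using N.emeasure_space_1 by (simp add: emeasure_density)
  finally show ?thesis by simp
qed

lemma nn_integral_normal_exp_square:
  assumes s: "s > 0" and t: "t < 1/2"
  shows "(\<integral>\<^sup>+x. ennreal (exp (t * (x\<^sup>2 / s\<^sup>2))) \<partial>density lborel (normal_density 0 s))
    = ennreal (1 / sqrt (1 - 2 * t))"
proof -
  \<comment> \<open>Tilting by \<open>t\<close> times the normalized square gives another centred
    normal density, with standard deviation \<open>q\<close>, up to the factor that becomes the
    value of the integral.\<close>
  define q where "q = s / sqrt (1 - 2 * t)"
  have q: "q > 0" "q\<^sup>2 = s\<^sup>2 / (1 - 2 * t)"
    using s t by (auto simp: q_def power_divide)
  interpret N: prob_space "density lborel (normal_density 0 q)"
    using q(1) by (rule prob_space_normal_density)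
  have "normal_density 0 s x * exp (t * (x\<^sup>2 / s\<^sup>2)) = 1 / sqrt (1 - 2 * t) * normal_density 0 q x" for x
  proof -
    have "- x\<^sup>2 / (2 * s\<^sup>2) + t * (x\<^sup>2 / s\<^sup>2) = - x\<^sup>2 / (2 * q\<^sup>2)"
      using s t by (simp add: q(2) field_simps)
    then have "exp (- x\<^sup>2 / (2 * s\<^sup>2)) * exp (t * (x\<^sup>2 / s\<^sup>2)) = exp (- x\<^sup>2 / (2 * q\<^sup>2))"
      by (simp add: exp_add[symmetric])
    moreover have "sqrt (2 * pi * q\<^sup>2) = sqrt (2 * pi * s\<^sup>2) / sqrt (1 - 2 * t)"
      by (simp add: q(2) real_sqrt_divide)
    ultimately show ?thesis
      using s t by (simp add: normal_density_def)
  qed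
  then have "(\<integral>\<^sup>+x. ennreal (exp (t * (x\<^sup>2 / s\<^sup>2))) \<partial>density lborel (normal_density 0 s))
      = (\<integral>\<^sup>+x. ennreal (1 / sqrt (1 - 2 * t)) * ennreal (normal_density 0 q x) \<partial>lborel)"
    using t by (subst nn_integral_density)
      (auto simp: ennreal_mult[symmetric] simp del: times_divide_eq_left intro!: nn_integral_cong)
  also have "\<dots> = ennreal (1 / sqrt (1 - 2 * t)) * (\<integral>\<^sup>+x. ennreal (normal_density 0 q x) \<partial>lborel)"
    by (rule nn_integral_cmult) simp
  also have "(\<integral>\<^sup>+x. ennreal (normal_density 0 q x) \<partial>lborel) = 1"
    using N.emeasure_space_1 by (simp add: emeasure_density)
  finally show ?thesis by simp
qed

section \<open>Measurability and tail bounds for Gaussian vectors\<close>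

lemma prob_space_gauss_vec: "s > 0 \<Longrightarrow> prob_space (gauss_vec d s)"
  unfolding gauss_vec_def by (intro prob_space_PiM prob_space_normal_density)

lemma sets_gauss_vec: "sets (gauss_vec d s) = sets (PiM {..<d} (\<lambda>_. borel))"
  unfolding gauss_vec_def by (intro sets_PiM_cong) auto

lemma gauss_vec_coordinate [measurable]: "k < d \<Longrightarrow> (\<lambda>u. u k) \<in> borel_measurable (gauss_vec d s)"
  by (subst measurable_cong_sets[OF sets_gauss_vec refl]) simp

lemma dotp_measurable [measurable (raw)]:
  assumes "f \<in> measurable M (gauss_vec d s)" "g \<in> measurable M (gauss_vec d s')"
  shows "(\<lambda>x. dotp d (f x) (g x)) \<in> borel_measurable M"
  unfolding dotp_def
  by (intro borel_measurable_sum borel_measurable_times measurable_compose[OF assms(1) gauss_vec_coordinate]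
      measurable_compose[OF assms(2) gauss_vec_coordinate]) auto

lemma dotp_const_measurable [measurable (raw)]:
  assumes "f \<in> measurable M (gauss_vec d s)"
  shows "(\<lambda>x. dotp d (f x) v) \<in> borel_measurable M"
  unfolding dotp_def
  by (intro borel_measurable_sum borel_measurable_times measurable_compose[OF assms gauss_vec_coordinate]) auto

lemma vnorm_sq: "(vnorm d v)\<^sup>2 = dotp d v v"
  by (simp add: L2_set_def dotp_def sum_nonneg power2_eq_square)

lemma vnorm_measurable [measurable (raw)]:
  assumes "f \<in> measurable M (gauss_vec d s)"
  shows "(\<lambda>x. vnorm d (f x)) \<in> borel_measurable M"
proof -
  have "vnorm d v = sqrt (dotp d v v)" for v
    by (simp add: L2_set_def dotp_def power2_eq_square)
  then show ?thesis
    using assms by simp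
qed

lemma gauss_vec_dotp_upper_tail:
  assumes s: "s > 0" and L: "L \<ge> 0" and v: "vnorm d v > 0"
  shows "emeasure (gauss_vec d s) {u \<in> space (gauss_vec d s). s * vnorm d v * sqrt (2 * L) \<le> dotp d u v}
    \<le> ennreal (exp (- L))"
proof -
  \<comment> \<open>The minimizer of the Chernoff exponent: the moments contribute \<open>L\<close>,
    the threshold \<open>- 2 * L\<close>.\<close>
  define a where "a = sqrt (2 * L) / (s * vnorm d v)"
  have a0: "a \<ge> 0" using L s v by (simp add: a_def)
  let ?G = "gauss_vec d s"
  have "emeasure ?G {u \<in> space ?G. 2 * L \<le> (\<Sum>k<d. a * v k * u k)}
      \<le> ennreal (exp ((\<Sum>k<d. (a * v k)\<^sup>2 * s\<^sup>2 / 2) - 2 * L))"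
    unfolding gauss_vec_def using s
    by (intro emeasure_PiM_Chernoff) (auto simp: nn_integral_normal_exp_linear intro: prob_space_normal_density)
  also have "(\<Sum>k<d. (a * v k)\<^sup>2 * s\<^sup>2 / 2) = a\<^sup>2 * s\<^sup>2 / 2 * (vnorm d v)\<^sup>2"
    unfolding vnorm_sq dotp_def by (simp add: sum_distrib_left power_mult_distrib power2_eq_square mult_ac)
  also have "\<dots> = L"
    using s v L by (simp add: a_def power_divide power_mult_distrib)
  finally have *: "emeasure ?G {u \<in> space ?G. 2 * L \<le> (\<Sum>k<d. a * v k * u k)} \<le> ennreal (exp (- L))"
    by simp
  have "{u \<in> space ?G. s * vnorm d v * sqrt (2 * L) \<le> dotp d u v}
      \<subseteq> {u \<in> space ?G. 2 * L \<le> (\<Sum>k<d. a * v k * u k)}"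
  proof safe
    fix u assume "s * vnorm d v * sqrt (2 * L) \<le> dotp d u v"
    then have "a * (s * vnorm d v * sqrt (2 * L)) \<le> a * dotp d u v"
      using a0 by (rule mult_left_mono)
    moreover have "a * (s * vnorm d v * sqrt (2 * L)) = 2 * L"
      using s v L by (simp add: a_def)
    ultimately show "2 * L \<le> (\<Sum>k<d. a * v k * u k)"
      by (simp add: dotp_def sum_distrib_left mult_ac)
  qed
  then have "emeasure ?G {u \<in> space ?G. s * vnorm d v * sqrt (2 * L) \<le> dotp d u v}
      \<le> emeasure ?G {u \<in> space ?G. 2 * L \<le> (\<Sum>k<d. a * v k * u k)}"
    by (rule emeasure_mono) (auto intro!: sets.sets_Collect borel_measurable_sum)
  with * show ?thesis by (rule order_trans[rotated])
qed

lemma vnorm_uminus [simp]: "vnorm d (\<lambda>k. - v k) = vnorm d v"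
  by (simp add: L2_set_def)

lemma dotp_uminus_right [simp]: "dotp d u (\<lambda>k. - v k) = - dotp d u v"
  by (simp add: dotp_def sum_negf)

lemma dotp_vnorm_0: "vnorm d v = 0 \<Longrightarrow> dotp d u v = 0"
  by (auto simp: L2_set_eq_0_iff dotp_def)

text \<open>The one-sided bound for \<open>v\<close> and for its negative. The strict inequality in
  the event matters: it makes the event empty when \<open>v\<close> has norm 0, so the bound holds
  for every \<open>v\<close>.\<close>

lemma gauss_vec_dotp_tail:
  assumes s: "s > 0" and L: "L \<ge> 0"
  shows "emeasure (gauss_vec d s) {u \<in> space (gauss_vec d s). s * vnorm d v * sqrt (2 * L) < \<bar>dotp d u v\<bar>}
    \<le> ennreal (2 * exp (- L))"
proof (cases "vnorm d v = 0")
  case True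
  then show ?thesis by (simp add: dotp_vnorm_0)
next
  case False
  then have v: "vnorm d v > 0" "vnorm d (\<lambda>k. - v k) > 0"
    using L2_set_nonneg[of v "{..<d}"] by (simp_all add: less_le)
  let ?G = "gauss_vec d s"
  let ?A = "\<lambda>v. {u \<in> space ?G. s * vnorm d v * sqrt (2 * L) \<le> dotp d u v}"
  have sets: "?A w \<in> sets ?G" for w
    by measurable
  have "{u \<in> space ?G. s * vnorm d v * sqrt (2 * L) < \<bar>dotp d u v\<bar>} \<subseteq> ?A v \<union> ?A (\<lambda>k. - v k)"
    by auto
  then have "emeasure ?G {u \<in> space ?G. s * vnorm d v * sqrt (2 * L) < \<bar>dotp d u v\<bar>}
      \<le> emeasure ?G (?A v \<union> ?A (\<lambda>k. - v k))"
    by (rule emeasure_mono) (intro sets.Un sets)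
  also have "\<dots> \<le> emeasure ?G (?A v) + emeasure ?G (?A (\<lambda>k. - v k))"
    by (intro emeasure_subadditive sets)
  also have "\<dots> \<le> ennreal (exp (- L)) + ennreal (exp (- L))"
    by (intro add_mono gauss_vec_dotp_upper_tail assms v)
  finally show ?thesis by (simp add: ennreal_plus[symmetric] del: ennreal_plus)
qed

text \<open>One Chernoff bound serves both tails; the sign of the tilt \<open>t\<close> selects the
  tail.\<close>

lemma gauss_vec_norm_tails:
  assumes s: "s > 0"
  shows "emeasure (gauss_vec d s) {u \<in> space (gauss_vec d s). 2 * (s\<^sup>2 * d) < (vnorm d u)\<^sup>2}
      \<le> ennreal (exp (- real d / 8))" (is ?upper)
    and "emeasure (gauss_vec d s) {u \<in> space (gauss_vec d s). (vnorm d u)\<^sup>2 < s\<^sup>2 * d / 4}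
      \<le> ennreal (exp (- real d / 8))" (is ?lower)
proof -
  let ?G = "gauss_vec d s"
  have chernoff: "emeasure ?G A \<le> ennreal (exp (- real d / 8))"
    if t: "t < 1/2" "- ln (1 - 2 * t) / 2 - b \<le> - 1 / 8"
      and A: "A \<subseteq> {u \<in> space ?G. b * d \<le> t * ((vnorm d u)\<^sup>2 / s\<^sup>2)}" for t b :: real and A
  proof -
    have "1 / sqrt (1 - 2 * t) = exp (- ln (1 - 2 * t) / 2)"
      using t by (simp add: ln_sqrt[symmetric] exp_minus inverse_eq_divide)
    then have "emeasure ?G {u \<in> space ?G. b * d \<le> (\<Sum>k<d. t * ((u k)\<^sup>2 / s\<^sup>2))}
        \<le> ennreal (exp ((\<Sum>k<d. - ln (1 - 2 * t) / 2) - b * d))"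
      unfolding gauss_vec_def using s t
      by (intro emeasure_PiM_Chernoff)
        (auto simp: nn_integral_normal_exp_square simp del: times_divide_eq_right intro: prob_space_normal_density)
    also have "(\<Sum>k<d. - ln (1 - 2 * t) / 2) - b * d = (- ln (1 - 2 * t) / 2 - b) * d"
      by (simp add: algebra_simps)
    also have "\<dots> \<le> (- 1 / 8) * d"
      using t by (intro mult_right_mono) auto
    finally have "emeasure ?G {u \<in> space ?G. b * d \<le> (\<Sum>k<d. t * ((u k)\<^sup>2 / s\<^sup>2))} \<le> ennreal (exp (- real d / 8))"
      by (simp add: ennreal_leI)
    moreover have "(\<Sum>k<d. t * ((u k)\<^sup>2 / s\<^sup>2)) = t * ((vnorm d u)\<^sup>2 / s\<^sup>2)" for u
      by (simp add: L2_set_def sum_nonneg sum_distrib_left sum_divide_distrib)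
    ultimately have le: "emeasure ?G {u \<in> space ?G. b * d \<le> t * ((vnorm d u)\<^sup>2 / s\<^sup>2)} \<le> ennreal (exp (- real d / 8))"
      by simp
    have "emeasure ?G A \<le> emeasure ?G {u \<in> space ?G. b * d \<le> t * ((vnorm d u)\<^sup>2 / s\<^sup>2)}"
      using A by (rule emeasure_mono) measurable
    then show ?thesis using le by (rule order_trans)
  qed
  \<comment> \<open>The tilts \<open>1/4\<close> and \<open>-1/2\<close> leave the exponents
    \<open>(ln 2 - 1) / 2\<close> and \<open>1/8 - ln 2 / 2\<close> per coordinate, both below
    \<open>- 1/8\<close>.\<close>
  show ?upper
    by (intro chernoff[of "1/4" "1/2"]) (use ln2_le_25_over_36 s in \<open>auto simp: ln_div field_simps\<close>)
  show ?lower
    by (intro chernoff[of "-1/2" "-1/8"]) (use ln2_ge_two_thirds s in \<open>auto simp: field_simps\<close>)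
qed

section \<open>Events with small failure probability\<close>

text \<open>Only a measurable set of good outcomes is demanded, as in the theorem. \<open>Q\<close>
  itself may be nonmeasurable, so conjunctions and weakenings need no measurability proof.\<close>

definition holds_with_failure :: "'a measure \<Rightarrow> real \<Rightarrow> ('a \<Rightarrow> bool) \<Rightarrow> bool" where
  "holds_with_failure M q Q \<longleftrightarrow> (\<exists>A\<in>sets M. 1 - q \<le> measure M A \<and> (\<forall>\<omega>\<in>A. Q \<omega>))"

lemma (in prob_space) holds_with_failureI:
  assumes B: "{\<omega> \<in> space M. \<not> Q \<omega>} \<in> sets M" and q: "emeasure M {\<omega> \<in> space M. \<not> Q \<omega>} \<le> ennreal q"
    and q0: "q \<ge> 0"
  shows "holds_with_failure M q Q"
  unfolding holds_with_failure_def
proof (intro bexI conjI ballI)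
  let ?B = "{\<omega> \<in> space M. \<not> Q \<omega>}"
  show "1 - q \<le> prob (space M - ?B)"
    using q q0 by (simp add: prob_compl[OF B] emeasure_eq_measure)
  show "space M - ?B \<in> sets M" using B by auto
qed auto

lemma (in prob_space) holds_with_failure_conj:
  assumes "holds_with_failure M q Q" "holds_with_failure M q' Q'"
  shows "holds_with_failure M (q + q') (\<lambda>\<omega>. Q \<omega> \<and> Q' \<omega>)"
proof -
  obtain A A' where A: "A \<in> sets M" "1 - q \<le> prob A" "\<forall>\<omega>\<in>A. Q \<omega>"
    and A': "A' \<in> sets M" "1 - q' \<le> prob A'" "\<forall>\<omega>\<in>A'. Q' \<omega>"
    using assms unfolding holds_with_failure_def by auto
  have "prob (A \<union> A') = prob A + prob A' - prob (A \<inter> A')"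
    using A A' by (simp add: measure_Un3 fmeasurable_eq_sets)
  with A A' prob_le_1[of "A \<union> A'"] have "1 - (q + q') \<le> prob (A \<inter> A')"
    by linarith
  with A A' show ?thesis
    unfolding holds_with_failure_def by (intro bexI[of _ "A \<inter> A'"]) auto
qed

lemma (in prob_space) holds_with_failure_ball:
  assumes "finite I" "\<And>i. i \<in> I \<Longrightarrow> holds_with_failure M q (Q i)"
  shows "holds_with_failure M (real (card I) * q) (\<lambda>\<omega>. \<forall>i\<in>I. Q i \<omega>)"
  using assms
proof (induction I)
  case empty
  then show ?case
    by (auto simp: holds_with_failure_def prob_space intro!: bexI[of _ "space M"])
next
  case (insert i I)
  then show ?case
    using holds_with_failure_conj[of q "Q i" "real (card I) * q" "\<lambda>\<omega>. \<forall>i\<in>I. Q i \<omega>"]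
    by (simp add: algebra_simps)
qed

lemma holds_with_failure_mono:
  "holds_with_failure M q Q \<Longrightarrow> q \<le> q' \<Longrightarrow> (\<And>\<omega>. Q \<omega> \<Longrightarrow> Q' \<omega>) \<Longrightarrow> holds_with_failure M q' Q'"
  unfolding holds_with_failure_def
  by (meson diff_left_mono order_trans)

text \<open>Lets an event be proved on a marginal, where the tail bounds live, and pulled back along
  a measure-preserving map.\<close>

lemma holds_with_failure_distr:
  assumes "X \<in> measurable M N" "distr M N X = N" "holds_with_failure N q Q"
  shows "holds_with_failure M q (\<lambda>\<omega>. Q (X \<omega>))"
proof -
  obtain A where A: "A \<in> sets N" "1 - q \<le> measure N A" "\<forall>\<omega>\<in>A. Q \<omega>"
    using assms(3) unfolding holds_with_failure_def by auto
  have "measure M (X -` A \<inter> space M) = measure (distr M N X) A"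
    using A assms(1) by (simp add: measure_distr)
  with A assms show ?thesis
    unfolding holds_with_failure_def by (intro bexI[of _ "X -` A \<inter> space M"]) auto
qed

section \<open>Typical training data and initialization\<close>

abbreviation sample_law :: "setting \<Rightarrow> ((int \<times> int) \<times> rvec) measure" where
  "sample_law P \<equiv> measure_pmf (label_pmf (flip_pos P) (flip_neg P)) \<Otimes>\<^sub>M gauss_vec (dm P) (sd_noise P)"

lemma nn_integral_label_pmf:
  assumes "0 \<le> a" "a \<le> 1" "0 \<le> b" "b \<le> 1"
  shows "(\<integral>\<^sup>+x. f x \<partial>measure_pmf (label_pmf a b)) =
    (f (1, -1) * ennreal a + f (1, 1) * ennreal (1 - a) + (f (-1, 1) * ennreal b + f (-1, -1) * ennreal (1 - b))) / 2"
  using assms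
  by (simp add: label_pmf_def nn_integral_pmf_of_set)

lemma set_label_pmf: "set_pmf (label_pmf a b) \<subseteq> {1, -1} \<times> {1, -1}"
  by (auto simp: label_pmf_def set_pmf_of_set split: if_splits)

text \<open>For labels 1 and -1, a clean sample of class \<open>s\<close> counts 1, a noisy one -1
  and a sample of the other class 0, so the sum is the surplus of clean over noisy samples in the
  class.\<close>

definition class_margin :: "int \<Rightarrow> int \<times> int \<Rightarrow> real" where
  "class_margin s yl = of_bool (fst yl = s) * of_int (snd yl) * of_int (fst yl)"

lemma exp_le_quadratic:
  fixes x :: real
  assumes "\<bar>x\<bar> \<le> 1"
  shows "exp x \<le> 1 + x + x\<^sup>2"
proof (cases "x \<ge> 0")
  case True
  then show ?thesis using exp_bound[of x] assms by simp
next
  case False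
  \<comment> \<open>The product is \<open>1 - x ^ 3\<close>, which is at least 1 for negative
    \<open>x\<close>.\<close>
  have "1 \<le> (1 + x + x\<^sup>2) * (1 - x)"
    using False mult_nonpos_nonneg[of x "x * x"] by (simp add: algebra_simps power2_eq_square)
  also have "\<dots> \<le> (1 + x + x\<^sup>2) * exp (- x)"
    using exp_ge_add_one_self[of "-x"] sum_power2_ge_zero[of "x + 1" x] assms False
    by (intro mult_left_mono) auto
  finally show ?thesis by (simp add: exp_minus field_simps)
qed

text \<open>Half of the mass lies outside class \<open>s\<close> and contributes the constant 1; on
  the other half a flip probability of at most \<tau> gives conditional mean at least
  \<open>1 - 2 * \<tau>\<close>. Hence the halved quadratic and linear terms.\<close>

lemma class_margin_mgf:
  assumes a: "0 < a" "a \<le> \<tau>" and b: "0 < b" "b \<le> \<tau>" and \<tau>: "\<tau> < 1/2" and l: "0 \<le> l" "l \<le> 1"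
    and s: "s \<in> {1, -1}"
  shows "(\<integral>\<^sup>+x. ennreal (exp (- l * class_margin s x)) \<partial>measure_pmf (label_pmf a b))
    \<le> ennreal (exp (l\<^sup>2 / 2 - (1 - 2 * \<tau>) / 2 * l))"
proof -
  have main: "(exp l * c + exp (- l) * (1 - c) + 1) / 2 \<le> exp (l\<^sup>2 / 2 - (1 - 2 * \<tau>) / 2 * l)"
    if c: "0 < c" "c \<le> \<tau>" for c
  proof -
    have "exp l * c \<le> (1 + l + l\<^sup>2) * c"
      using l c by (intro mult_right_mono exp_le_quadratic) auto
    moreover have "exp (- l) * (1 - c) \<le> (1 - l + l\<^sup>2) * (1 - c)"
      using l c \<tau> exp_le_quadratic[of "- l"] by (intro mult_right_mono) auto
    moreover have "l * c \<le> l * \<tau>"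
      using l c by (intro mult_left_mono) auto
    moreover have "(1 + l + l\<^sup>2) * c + (1 - l + l\<^sup>2) * (1 - c) = 1 - l + l\<^sup>2 + 2 * (l * c)"
      by (simp add: algebra_simps)
    ultimately have "exp l * c + exp (- l) * (1 - c) \<le> 1 - l + l\<^sup>2 + 2 * (l * \<tau>)"
      by linarith
    then have "(exp l * c + exp (- l) * (1 - c) + 1) / 2 \<le> 1 + (l\<^sup>2 / 2 - (1 - 2 * \<tau>) / 2 * l)"
      by (simp add: field_simps)
    also have "\<dots> \<le> exp (l\<^sup>2 / 2 - (1 - 2 * \<tau>) / 2 * l)"
      by (rule exp_ge_add_one_self)
    finally show ?thesis .
  qed
  have collect: "(ennreal x * ennreal c + ennreal y * ennreal (1 - c) + (1 * ennreal c' + 1 * ennreal (1 - c'))) / 2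
      = ennreal ((x * c + y * (1 - c) + 1) / 2)"
    if "0 \<le> c" "c \<le> 1" "0 \<le> c'" "c' \<le> 1" "0 \<le> x" "0 \<le> y" for x y c c'
  proof -
    have "ennreal x * ennreal c + ennreal y * ennreal (1 - c) = ennreal (x * c + y * (1 - c))"
      using that by (simp add: ennreal_mult)
    moreover have "1 * ennreal c' + 1 * ennreal (1 - c') = ennreal 1"
      using that by (simp flip: ennreal_plus)
    moreover have "ennreal (x * c + y * (1 - c)) + ennreal 1 = ennreal (x * c + y * (1 - c) + 1)"
      using that by (intro ennreal_plus[symmetric]) auto
    moreover have "ennreal (x * c + y * (1 - c) + 1) / 2 = ennreal ((x * c + y * (1 - c) + 1) / 2)"
      using that by (subst divide_ennreal[of _ 2, symmetric]) auto
    ultimately show ?thesis by simp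
  qed
  have "(\<integral>\<^sup>+x. ennreal (exp (- l * class_margin s x)) \<partial>measure_pmf (label_pmf a b))
      = ennreal ((exp l * (if s = 1 then a else b) + exp (- l) * (1 - (if s = 1 then a else b)) + 1) / 2)"
  proof (cases "s = 1")
    case True
    then have "class_margin s (1, -1) = -1" "class_margin s (1, 1) = 1"
        "class_margin s (-1, 1) = 0" "class_margin s (-1, -1) = 0"
      by (auto simp: class_margin_def)
    then show ?thesis
      using a b \<tau> collect[of a b "exp l" "exp (- l)"] True
      by (subst nn_integral_label_pmf) auto
  next
    case False
    then have "s = - 1" using s by simp
    then have "class_margin s (1, -1) = 0" "class_margin s (1, 1) = 0"
        "class_margin s (-1, 1) = -1" "class_margin s (-1, -1) = 1"
      by (auto simp: class_margin_def)
    then show ?thesis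
      using a b \<tau> collect[of b a "exp l" "exp (- l)"] False
      by (subst nn_integral_label_pmf) (auto simp: add.commute)
  qed
  also have "\<dots> \<le> ennreal (exp (l\<^sup>2 / 2 - (1 - 2 * \<tau>) / 2 * l))"
    using main[OF a] main[OF b] by (intro ennreal_leI) simp
  finally show ?thesis .
qed

lemma distr_pair_snd:
  assumes N: "prob_space N" and M: "sigma_finite_measure M"
  shows "distr (N \<Otimes>\<^sub>M M) M snd = M"
proof (intro measure_eqI)
  interpret N: prob_space N by fact
  interpret M: sigma_finite_measure M by fact
  fix A assume A: "A \<in> sets (distr (N \<Otimes>\<^sub>M M) M snd)"
  then have "snd -` A \<inter> space (N \<Otimes>\<^sub>M M) = space N \<times> A"
    by (auto simp: space_pair_measure dest: sets.sets_into_space)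
  with A show "emeasure (distr (N \<Otimes>\<^sub>M M) M snd) A = emeasure M A"
    by (simp add: emeasure_distr M.emeasure_pair_measure_Times N.emeasure_space_1)
qed simp

text \<open>Measuring the inner product against the norm of the other vector makes the bound uniform in that
  vector, so that Fubini's theorem applies without conditioning on the norm.\<close>

lemma pair_gauss_vec_dotp_tail:
  assumes N: "prob_space N" and s: "s > 0" and L: "L \<ge> 0"
    and B: "{x \<in> space (N \<Otimes>\<^sub>M gauss_vec d s). s * vnorm d (V (fst x)) * sqrt (2 * L) < \<bar>dotp d (snd x) (V (fst x))\<bar>}
      \<in> sets (N \<Otimes>\<^sub>M gauss_vec d s)" (is "?B \<in> sets ?P")
  shows "holds_with_failure (N \<Otimes>\<^sub>M gauss_vec d s) (2 * exp (- L))
    (\<lambda>x. \<bar>dotp d (snd x) (V (fst x))\<bar> \<le> s * vnorm d (V (fst x)) * sqrt (2 * L))"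
proof -
  interpret G: prob_space "gauss_vec d s" using s by (rule prob_space_gauss_vec)
  interpret N: prob_space N by fact
  interpret pair_prob_space N "gauss_vec d s" ..
  have "emeasure ?P ?B = (\<integral>\<^sup>+v. emeasure (gauss_vec d s) (Pair v -` ?B) \<partial>N)"
    using B by (rule G.emeasure_pair_measure_alt)
  also have "\<dots> \<le> (\<integral>\<^sup>+v. ennreal (2 * exp (- L)) \<partial>N)"
  proof (rule nn_integral_mono)
    fix v assume "v \<in> space N"
    then have "Pair v -` ?B = {u \<in> space (gauss_vec d s). s * vnorm d (V v) * sqrt (2 * L) < \<bar>dotp d u (V v)\<bar>}"
      by (auto simp: space_pair_measure)
    then show "emeasure (gauss_vec d s) (Pair v -` ?B) \<le> ennreal (2 * exp (- L))"
      using gauss_vec_dotp_tail[OF s L] by simp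
  qed
  also have "\<dots> = ennreal (2 * exp (- L))"
    by (simp add: N.emeasure_space_1)
  finally show ?thesis
    using B by (intro P.holds_with_failureI) (simp_all add: not_le)
qed

section \<open>Lifting events from marginals to the training law\<close>

lemma prob_space_sample_law: "sd_noise P > 0 \<Longrightarrow> prob_space (sample_law P)"
  by (intro prob_space_pair prob_space_gauss_vec prob_space_measure_pmf)

lemma prob_space_training_law:
  "sd_noise P > 0 \<Longrightarrow> sd_init P > 0 \<Longrightarrow> prob_space (training_law P)"
  unfolding training_law_def
  by (intro prob_space_pair prob_space_PiM prob_space_sample_law prob_space_gauss_vec)

lemma training_law_samples:
  assumes P: "sd_noise P > 0" "sd_init P > 0"
    and Q: "holds_with_failure (PiM {..<ns P} (\<lambda>_. sample_law P)) q Q"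
  shows "holds_with_failure (training_law P) q (\<lambda>\<omega>. Q (fst \<omega>))"
  unfolding training_law_def using P
  by (intro holds_with_failure_distr[OF _ prob_space.distr_pair_fst Q] prob_space_PiM prob_space_gauss_vec) auto

lemma training_law_sample:
  assumes P: "sd_noise P > 0" "sd_init P > 0" and i: "i < ns P"
    and Q: "holds_with_failure (sample_law P) q Q"
  shows "holds_with_failure (training_law P) q (\<lambda>\<omega>. Q (fst \<omega> i))"
proof -
  have "distr (PiM {..<ns P} (\<lambda>_. sample_law P)) (sample_law P) (\<lambda>\<omega>. \<omega> i) = sample_law P"
    using i prob_space_sample_law[OF P(1)] by (intro distr_PiM_component) auto
  then show ?thesis
    using i by (intro training_law_samples[OF P] holds_with_failure_distr[OF _ _ Q]) auto
qed

lemma sample_law_noise: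
  assumes P: "sd_noise P > 0" and Q: "holds_with_failure (gauss_vec (dm P) (sd_noise P)) q Q"
  shows "holds_with_failure (sample_law P) q (\<lambda>x. Q (snd x))"
  using prob_space_gauss_vec[OF P] prob_space_measure_pmf
  by (intro holds_with_failure_distr[OF _ distr_pair_snd Q])
    (auto simp: prob_space_imp_sigma_finite)

lemma training_law_noise:
  assumes P: "sd_noise P > 0" "sd_init P > 0" and i: "i < ns P"
    and Q: "holds_with_failure (gauss_vec (dm P) (sd_noise P)) q Q"
  shows "holds_with_failure (training_law P) q (\<lambda>\<omega>. Q (noise \<omega> i))"
  unfolding noise_def using training_law_sample[OF P i sample_law_noise[OF P(1) Q]] .

lemma training_law_noise_pair:
  assumes P: "sd_noise P > 0" "sd_init P > 0" and i: "i < ns P" "i' < ns P" "i \<noteq> i'"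
    and Q: "holds_with_failure (gauss_vec (dm P) (sd_noise P) \<Otimes>\<^sub>M gauss_vec (dm P) (sd_noise P)) q Q"
  shows "holds_with_failure (training_law P) q (\<lambda>\<omega>. Q (noise \<omega> i, noise \<omega> i'))"
proof -
  let ?G = "gauss_vec (dm P) (sd_noise P)" and ?S = "sample_law P"
  have G: "prob_space ?G" and S: "prob_space ?S"
    using P by (auto intro: prob_space_gauss_vec prob_space_sample_law)
  have snd: "distr ?S ?G snd = ?G"
    using G by (intro distr_pair_snd prob_space_imp_sigma_finite prob_space_measure_pmf)
  have "distr (?S \<Otimes>\<^sub>M ?S) (?G \<Otimes>\<^sub>M ?G) (\<lambda>(x, y). (snd x, snd y)) = distr ?S ?G snd \<Otimes>\<^sub>M distr ?S ?G snd"
    using G by (intro pair_measure_distr[symmetric]) (auto simp: snd prob_space_imp_sigma_finite)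
  then have "holds_with_failure (?S \<Otimes>\<^sub>M ?S) q (\<lambda>x. Q (case x of (x, y) \<Rightarrow> (snd x, snd y)))"
    by (intro holds_with_failure_distr[OF _ _ Q]) (auto simp: snd)
  moreover have "distr (PiM {..<ns P} (\<lambda>_. ?S)) (?S \<Otimes>\<^sub>M ?S) (\<lambda>\<omega>. (\<omega> i, \<omega> i')) = ?S \<Otimes>\<^sub>M ?S"
    using i S by (intro distr_PiM_pair) auto
  moreover have "(\<lambda>\<omega>. (\<omega> i, \<omega> i')) \<in> measurable (PiM {..<ns P} (\<lambda>_. ?S)) (?S \<Otimes>\<^sub>M ?S)"
    using i by (intro measurable_Pair measurable_component_singleton) auto
  ultimately have "holds_with_failure (PiM {..<ns P} (\<lambda>_. ?S)) q (\<lambda>\<omega>. Q (snd (\<omega> i), snd (\<omega> i')))"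
    by (auto dest: holds_with_failure_distr)
  from training_law_samples[OF P this] show ?thesis
    by (simp add: noise_def)
qed

text \<open>Data and initialization are independent, so one noise vector and one initial weight
  vector have a product law. A \<open>Q\<close> that ignores the first component gives events on the
  initialization alone.\<close>

lemma training_law_noise_init:
  assumes P: "sd_noise P > 0" "sd_init P > 0" and i: "i < ns P" and jr: "j \<in> {1, -1}" "r < wd P"
    and Q: "holds_with_failure (gauss_vec (dm P) (sd_noise P) \<Otimes>\<^sub>M gauss_vec (dm P) (sd_init P)) q Q"
  shows "holds_with_failure (training_law P) q (\<lambda>\<omega>. Q (noise \<omega> i, init_weights \<omega> j r))"
proof -
  let ?G = "gauss_vec (dm P) (sd_noise P)" and ?S = "sample_law P" and ?H = "gauss_vec (dm P) (sd_init P)"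
  let ?Q = "PiM {..<ns P} (\<lambda>_. ?S)" and ?R = "PiM ({1, -1} \<times> {..<wd P}) (\<lambda>_. ?H)"
  have G: "prob_space ?G" and G0: "prob_space ?H" and S: "prob_space ?S"
    using P by (auto intro: prob_space_gauss_vec prob_space_sample_law)
  have "distr ?S ?G snd = ?G"
    using G by (intro distr_pair_snd prob_space_imp_sigma_finite prob_space_measure_pmf)
  moreover have "distr ?Q ?S (\<lambda>\<omega>. \<omega> i) = ?S"
    using S i by (intro distr_PiM_component) auto
  ultimately have f: "distr ?Q ?G (\<lambda>\<omega>. snd (\<omega> i)) = ?G"
    using i distr_distr[of snd ?S ?G "\<lambda>\<omega>. \<omega> i" ?Q] by (simp add: comp_def)
  have g: "distr ?R ?H (\<lambda>\<omega>. \<omega> (j, r)) = ?H"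
    using G0 jr by (intro distr_PiM_component) auto
  have mf: "(\<lambda>\<omega>. snd (\<omega> i)) \<in> measurable ?Q ?G" and mg: "(\<lambda>\<omega>. \<omega> (j, r)) \<in> measurable ?R ?H"
    using i jr by auto
  have "distr (?Q \<Otimes>\<^sub>M ?R) (?G \<Otimes>\<^sub>M ?H) (\<lambda>(x, y). (snd (x i), y (j, r))) = ?G \<Otimes>\<^sub>M ?H"
    using pair_measure_distr[OF mf mg] G0 by (simp add: f g prob_space_imp_sigma_finite)
  moreover have "(\<lambda>(x, y). (snd (x i), y (j, r))) \<in> measurable (?Q \<Otimes>\<^sub>M ?R) (?G \<Otimes>\<^sub>M ?H)"
    using mf mg by measurable
  ultimately have "holds_with_failure (?Q \<Otimes>\<^sub>M ?R) q (\<lambda>x. Q (case x of (x, y) \<Rightarrow> (snd (x i), y (j, r))))"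
    by (intro holds_with_failure_distr[OF _ _ Q])
  then show ?thesis
    by (simp add: noise_def init_weights_def training_law_def split_beta)
qed

text \<open>As far as the type goes, labels are arbitrary integers; that they are 1 or -1 holds
  almost surely, hence failure probability 0.\<close>

lemma sample_law_labels:
  assumes "sd_noise P > 0"
  shows "holds_with_failure (sample_law P) 0 (\<lambda>x. fst x \<in> {1, -1} \<times> {1, -1})"
proof -
  let ?L = "measure_pmf (label_pmf (flip_pos P) (flip_neg P))"
  have "measure ?L ({1, -1} \<times> {1, -1}) = 1"
    using set_label_pmf by (subst measure_pmf.prob_eq_1) (auto simp: AE_measure_pmf_iff)
  then have "holds_with_failure ?L 0 (\<lambda>x. x \<in> {1, -1} \<times> {1, -1})"
    unfolding holds_with_failure_def by (intro bexI[of _ "{1, -1} \<times> {1, -1}"]) simp_all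
  moreover have "distr (sample_law P) ?L fst = ?L"
    by (intro prob_space.distr_pair_fst prob_space_gauss_vec assms)
  ultimately show ?thesis
    by (intro holds_with_failure_distr[where X=fst and N="?L"] measurable_fst)
qed

text \<open>The summands have mean at least \<open>2 * p\<close>. Falling below half of this is
  bounded with the tilt \<open>p\<close>, whose exponent is
  \<open>p\<^sup>2 / 2 - 2 * p\<^sup>2 + p\<^sup>2 = - p\<^sup>2 / 2\<close> per sample.\<close>

lemma samples_class_margin:
  assumes P: "well_posed P" "flip_pos P \<le> \<tau>" "flip_neg P \<le> \<tau>" "\<tau> < 1/2" and s: "s \<in> {1, -1}"
  defines "p \<equiv> (1 - 2 * \<tau>) / 4"
  shows "holds_with_failure (PiM {..<ns P} (\<lambda>_. sample_law P)) (exp (- real (ns P) * p\<^sup>2 / 2))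
    (\<lambda>\<omega>. real (ns P) * p \<le> (\<Sum>i<ns P. class_margin s (fst (\<omega> i))))"
proof -
  let ?S = "sample_law P" and ?L = "measure_pmf (label_pmf (flip_pos P) (flip_neg P))"
  let ?Q = "PiM {..<ns P} (\<lambda>_. ?S)"
  have P': "sd_noise P > 0" "flip_pos P > 0" "flip_neg P > 0"
    using P by (auto simp: well_posed_def)
  have S: "prob_space ?S" using P'(1) by (rule prob_space_sample_law)
  interpret Q: prob_space ?Q using S by (intro prob_space_PiM)
  have p: "0 \<le> p" "p \<le> 1" using P P' by (auto simp: p_def)
  have meas: "(\<lambda>x. class_margin s (fst x)) \<in> borel_measurable ?S"
    by (rule measurable_compose[OF measurable_fst]) simp
  have "distr ?S ?L fst = ?L"
    using P' by (intro prob_space.distr_pair_fst prob_space_gauss_vec)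
  then have "(\<integral>\<^sup>+x. ennreal (exp (- p * class_margin s (fst x))) \<partial>?S)
      = (\<integral>\<^sup>+x. ennreal (exp (- p * class_margin s x)) \<partial>?L)"
    using nn_integral_distr[of fst ?S ?L "\<lambda>x. ennreal (exp (- p * class_margin s x))"] by simp
  also have "\<dots> \<le> ennreal (exp (p\<^sup>2 / 2 - (1 - 2 * \<tau>) / 2 * p))"
    using P P' p s by (intro class_margin_mgf) auto
  also have "(1 - 2 * \<tau>) / 2 * p = 2 * p * p"
    by (simp add: p_def)
  finally have mgf: "(\<integral>\<^sup>+x. ennreal (exp (- p * class_margin s (fst x))) \<partial>?S)
      \<le> ennreal (exp (p\<^sup>2 / 2 - 2 * p * p))" .
  have "emeasure ?Q {\<omega> \<in> space ?Q. - p * (ns P * p) \<le> (\<Sum>i<ns P. - p * class_margin s (fst (\<omega> i)))}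
      \<le> ennreal (exp ((\<Sum>i<ns P. p\<^sup>2 / 2 - 2 * p * p) - (- p * (ns P * p))))"
    using S meas mgf by (intro emeasure_PiM_Chernoff) auto
  also have "(\<Sum>i<ns P. p\<^sup>2 / 2 - 2 * p * p) - (- p * (ns P * p)) = - real (ns P) * p\<^sup>2 / 2"
    by (simp add: power2_eq_square algebra_simps)
  finally have le: "emeasure ?Q {\<omega> \<in> space ?Q. - p * (ns P * p) \<le> (\<Sum>i<ns P. - p * class_margin s (fst (\<omega> i)))}
      \<le> ennreal (exp (- real (ns P) * p\<^sup>2 / 2))" .
  have meas': "(\<lambda>\<omega>. \<Sum>i<ns P. c * class_margin s (fst (\<omega> i))) \<in> borel_measurable ?Q" for c
    by (intro borel_measurable_sum borel_measurable_times borel_measurable_const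
        measurable_compose[OF _ meas] measurable_component_singleton)
  have "{\<omega> \<in> space ?Q. \<not> real (ns P) * p \<le> (\<Sum>i<ns P. class_margin s (fst (\<omega> i)))}
      \<subseteq> {\<omega> \<in> space ?Q. - p * (ns P * p) \<le> (\<Sum>i<ns P. - p * class_margin s (fst (\<omega> i)))}"
  proof safe
    fix \<omega> assume "\<not> real (ns P) * p \<le> (\<Sum>i<ns P. class_margin s (fst (\<omega> i)))"
    then have "p * (\<Sum>i<ns P. class_margin s (fst (\<omega> i))) \<le> p * (ns P * p)"
      using p by (intro mult_left_mono) auto
    then show "- p * (ns P * p) \<le> (\<Sum>i<ns P. - p * class_margin s (fst (\<omega> i)))"
      by (simp add: sum_distrib_left sum_negf)
  qed
  then have "emeasure ?Q {\<omega> \<in> space ?Q. \<not> real (ns P) * p \<le> (\<Sum>i<ns P. class_margin s (fst (\<omega> i)))}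
      \<le> emeasure ?Q {\<omega> \<in> space ?Q. - p * (ns P * p) \<le> (\<Sum>i<ns P. - p * class_margin s (fst (\<omega> i)))}"
    using meas'[of "- p"] by (intro emeasure_mono) auto
  then show ?thesis
    using le meas'[of 1] by (intro Q.holds_with_failureI) (auto intro: order_trans)
qed

text \<open>Raw tail bounds without a smallness constant; Condition (C) makes them small in
  \<open>typical_controlled\<close>. The 4 under the root for pairs of noise vectors, instead of 2,
  pays for a union over \<open>n\<^sup>2\<close> pairs.\<close>

definition typical :: "setting \<Rightarrow> real \<Rightarrow> outcome \<Rightarrow> bool" where
  "typical P p \<omega> \<longleftrightarrow>
     (let d = dm P; n = ns P; m = wd P; s = sd_noise P; s0 = sd_init P; \<delta> = conf P in
       (\<forall>i<n. true_label \<omega> i \<in> {1, -1} \<and> obs_label \<omega> i \<in> {1, -1}) \<and>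
       (\<forall>q\<in>{1, -1}. real n * p \<le> (\<Sum>i<n. class_margin q (true_label \<omega> i, obs_label \<omega> i))) \<and>
       (\<forall>i<n. s\<^sup>2 * real d / 4 \<le> (vnorm d (noise \<omega> i))\<^sup>2 \<and> (vnorm d (noise \<omega> i))\<^sup>2 \<le> 2 * (s\<^sup>2 * real d)) \<and>
       (\<forall>i<n. \<forall>i'<n. i \<noteq> i' \<longrightarrow>
          \<bar>dotp d (noise \<omega> i') (noise \<omega> i)\<bar> \<le> s * vnorm d (noise \<omega> i) * sqrt (4 * ln (n / \<delta>))) \<and>
       (\<forall>i<n. \<bar>dotp d (noise \<omega> i) (sig P)\<bar> \<le> s * vnorm d (sig P) * sqrt (2 * ln (n / \<delta>))) \<and>
       (\<forall>j\<in>{1, -1}. \<forall>r<m. \<bar>dotp d (init_weights \<omega> j r) (sig P)\<bar> \<le> s0 * vnorm d (sig P) * sqrt (2 * ln (m / \<delta>))) \<and>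
       (\<forall>j\<in>{1, -1}. \<forall>r<m. \<forall>i<n.
          \<bar>dotp d (init_weights \<omega> j r) (noise \<omega> i)\<bar> \<le> s0 * vnorm d (noise \<omega> i) * sqrt (2 * ln (real n * real m / \<delta>))))"

text \<open>The 16 collects 0 for the labels, 2 for the margins of the two classes, 2 each for the
  norms, the noise pairs and the noise-signal products, and 4 for each of the two initialization
  events, which range over both values of \<open>j\<close>.\<close>

lemma typical_probable:
  fixes p :: real
  assumes P: "well_posed P" "flip_pos P \<le> \<tau>" "flip_neg P \<le> \<tau>" "\<tau> < 1/2"
  defines "p \<equiv> (1 - 2 * \<tau>) / 4"
  assumes d: "ln (real (ns P) / conf P) \<le> real (dm P) / 8" and n: "ln (1 / conf P) \<le> real (ns P) * p\<^sup>2 / 2"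
  shows "holds_with_failure (training_law P) (16 * conf P) (typical P p)"
proof -
  define N M \<delta> where "N = real (ns P)" and "M = real (wd P)" and "\<delta> = conf P"
  let ?T = "training_law P" and ?G = "gauss_vec (dm P) (sd_noise P)" and ?H = "gauss_vec (dm P) (sd_init P)"
  have sd: "sd_noise P > 0" "sd_init P > 0" and NM: "N \<ge> 1" "M \<ge> 1" and \<delta>: "0 < \<delta>" "\<delta> < 1" and ns0: "0 < ns P"
    using P by (auto simp: well_posed_def N_def M_def \<delta>_def)
  interpret T: prob_space ?T using sd by (rule prob_space_training_law)
  interpret G: prob_space ?G using sd(1) by (rule prob_space_gauss_vec)
  interpret H: prob_space ?H using sd(2) by (rule prob_space_gauss_vec)
  have exp_ln: "exp (- ln x) = 1 / x" if "x > 0" for x :: real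
    using that by (simp add: exp_minus inverse_eq_divide)
  have ln0: "ln (N / \<delta>) \<ge> 0" "ln (M / \<delta>) \<ge> 0" "ln (N * M / \<delta>) \<ge> 0"
    using NM \<delta> mult_mono[of 1 N 1 M] by (simp_all add: field_simps)

  have labels: "holds_with_failure ?T (N * 0)
      (\<lambda>\<omega>. \<forall>i\<in>{..<ns P}. fst (fst \<omega> i) \<in> {1, -1} \<times> {1, -1})"
    using T.holds_with_failure_ball[OF _ training_law_sample[OF sd _ sample_law_labels[OF sd(1)]], of "{..<ns P}"]
    by (simp add: N_def)

  have "exp (- real (ns P) * p\<^sup>2 / 2) \<le> exp (- ln (1 / \<delta>))"
    using n by (simp add: \<delta>_def)
  also have "\<dots> = \<delta>" using \<delta> by (subst exp_ln) auto
  finally have margin: "holds_with_failure ?T \<delta>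
      (\<lambda>\<omega>. real (ns P) * p \<le> (\<Sum>i<ns P. class_margin q (fst (fst \<omega> i))))" if "q \<in> {1, -1}" for q
    using training_law_samples[OF sd samples_class_margin[OF P that]]
    by (auto simp: p_def elim: holds_with_failure_mono)
  have margins: "holds_with_failure ?T (2 * \<delta>)
      (\<lambda>\<omega>. \<forall>q\<in>{1, -1}. real (ns P) * p \<le> (\<Sum>i<ns P. class_margin q (fst (fst \<omega> i))))"
    using T.holds_with_failure_conj[OF margin[of 1] margin[of "-1"]] by simp

  have "exp (- real (dm P) / 8) \<le> exp (- ln (N / \<delta>))"
    using d by (simp add: \<delta>_def N_def)
  also have "\<dots> = \<delta> / N" using \<delta> NM by (subst exp_ln) auto
  finally have tail: "ennreal (exp (- real (dm P) / 8)) \<le> ennreal (\<delta> / N)"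
    by (rule ennreal_leI)
  have "holds_with_failure ?G (\<delta> / N) (\<lambda>u. \<not> (vnorm (dm P) u)\<^sup>2 < (sd_noise P)\<^sup>2 * real (dm P) / 4)"
    using \<delta> NM tail gauss_vec_norm_tails(2)[OF sd(1), of "dm P"]
    by (intro G.holds_with_failureI) (auto intro: order_trans)
  moreover have "holds_with_failure ?G (\<delta> / N) (\<lambda>u. \<not> 2 * ((sd_noise P)\<^sup>2 * real (dm P)) < (vnorm (dm P) u)\<^sup>2)"
    using \<delta> NM tail gauss_vec_norm_tails(1)[OF sd(1), of "dm P"]
    by (intro G.holds_with_failureI) (auto intro: order_trans)
  ultimately have norm: "holds_with_failure ?G (\<delta> / N + \<delta> / N)
     (\<lambda>u. \<not> (vnorm (dm P) u)\<^sup>2 < (sd_noise P)\<^sup>2 * real (dm P) / 4 \<and>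
       \<not> 2 * ((sd_noise P)\<^sup>2 * real (dm P)) < (vnorm (dm P) u)\<^sup>2)"
    by (rule G.holds_with_failure_conj)
  have norms: "holds_with_failure ?T (2 * \<delta>) (\<lambda>\<omega>. \<forall>i\<in>{..<ns P}.
      \<not> (vnorm (dm P) (noise \<omega> i))\<^sup>2 < (sd_noise P)\<^sup>2 * real (dm P) / 4 \<and>
      \<not> 2 * ((sd_noise P)\<^sup>2 * real (dm P)) < (vnorm (dm P) (noise \<omega> i))\<^sup>2)"
    using T.holds_with_failure_ball[OF _ training_law_noise[OF sd _ norm], of "{..<ns P}"] NM
    by (simp add: N_def)

  \<comment> \<open>Doubling the logarithm squares the failure probability, to match the number of
    pairs.\<close>
  have "exp (- (2 * ln (N / \<delta>))) = (\<delta> / N)\<^sup>2"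
    using \<delta> NM exp_ln[of "N / \<delta>"] by (simp add: exp_double[of "- ln (N / \<delta>)", simplified])
  then have pair: "holds_with_failure (?G \<Otimes>\<^sub>M ?G) (2 * (\<delta> / N)\<^sup>2) (\<lambda>x. \<bar>dotp (dm P) (snd x) (fst x)\<bar> \<le>
      sd_noise P * vnorm (dm P) (fst x) * sqrt (2 * (2 * ln (N / \<delta>))))"
    using pair_gauss_vec_dotp_tail[OF G.prob_space_axioms sd(1), of "2 * ln (N / \<delta>)" "dm P" "\<lambda>v. v"] ln0
    by simp
  have cross: "holds_with_failure ?T (2 * (\<delta> / N)\<^sup>2) (\<lambda>\<omega>. fst ii \<noteq> snd ii \<longrightarrow> \<bar>dotp (dm P) (noise \<omega> (snd ii)) (noise \<omega> (fst ii))\<bar> \<le>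
      sd_noise P * vnorm (dm P) (noise \<omega> (fst ii)) * sqrt (2 * (2 * ln (N / \<delta>))))"
    if "ii \<in> {..<ns P} \<times> {..<ns P}" for ii
  proof (cases "fst ii = snd ii")
    case True
    have "holds_with_failure ?T (2 * (\<delta> / N)\<^sup>2) (\<lambda>_. True)"
      using T.prob_space by (auto simp: holds_with_failure_def intro!: bexI[of _ "space ?T"])
    with True show ?thesis by simp
  next
    case False
    have "fst ii < ns P" "snd ii < ns P" using that by auto
    from training_law_noise_pair[OF sd this False pair] False show ?thesis by simp
  qed
  have "N\<^sup>2 * (2 * (\<delta> / N)\<^sup>2) \<le> 2 * \<delta>"
    using NM \<delta> by (simp add: power_divide power2_eq_square mult_left_le)
  then have card: "real (card ({..<ns P} \<times> {..<ns P})) * (2 * (\<delta> / N)\<^sup>2) \<le> 2 * \<delta>"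
    by (simp add: card_cartesian_product N_def power2_eq_square)
  have "holds_with_failure ?T (real (card ({..<ns P} \<times> {..<ns P})) * (2 * (\<delta> / N)\<^sup>2))
     (\<lambda>\<omega>. \<forall>ii\<in>{..<ns P} \<times> {..<ns P}. fst ii \<noteq> snd ii \<longrightarrow>
      \<bar>dotp (dm P) (noise \<omega> (snd ii)) (noise \<omega> (fst ii))\<bar> \<le>
      sd_noise P * vnorm (dm P) (noise \<omega> (fst ii)) * sqrt (2 * (2 * ln (N / \<delta>))))"
    by (intro T.holds_with_failure_ball cross) auto
  then have crosses: "holds_with_failure ?T (2 * \<delta>) (\<lambda>\<omega>. \<forall>ii\<in>{..<ns P} \<times> {..<ns P}. fst ii \<noteq> snd ii \<longrightarrow>
      \<bar>dotp (dm P) (noise \<omega> (snd ii)) (noise \<omega> (fst ii))\<bar> \<le>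
      sd_noise P * vnorm (dm P) (noise \<omega> (fst ii)) * sqrt (2 * (2 * ln (N / \<delta>))))"
    using card by (rule holds_with_failure_mono)

  have "holds_with_failure ?G (2 * exp (- ln (N / \<delta>))) (\<lambda>u. \<bar>dotp (dm P) u (sig P)\<bar> \<le>
      sd_noise P * vnorm (dm P) (sig P) * sqrt (2 * ln (N / \<delta>)))"
    using gauss_vec_dotp_tail[OF sd(1) ln0(1), of "dm P" "sig P"]
    by (intro G.holds_with_failureI) (auto simp: not_le)
  then have "holds_with_failure ?G (2 * (\<delta> / N)) (\<lambda>u. \<bar>dotp (dm P) u (sig P)\<bar> \<le>
      sd_noise P * vnorm (dm P) (sig P) * sqrt (2 * ln (N / \<delta>)))"
    using \<delta> NM by (subst (asm) exp_ln) auto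
  from T.holds_with_failure_ball[OF _ training_law_noise[OF sd _ this], of "{..<ns P}"]
  have noise_sig: "holds_with_failure ?T (2 * \<delta>) (\<lambda>\<omega>. \<forall>i\<in>{..<ns P}. \<bar>dotp (dm P) (noise \<omega> i) (sig P)\<bar> \<le>
      sd_noise P * vnorm (dm P) (sig P) * sqrt (2 * ln (N / \<delta>)))"
    using NM by (simp add: N_def)

  \<comment> \<open>An event about the initialization alone, routed through the pair with noise
    vector 0.\<close>
  have "holds_with_failure (?G \<Otimes>\<^sub>M ?H) (2 * exp (- ln (M / \<delta>))) (\<lambda>x. \<bar>dotp (dm P) (snd x) (sig P)\<bar> \<le>
      sd_init P * vnorm (dm P) (sig P) * sqrt (2 * ln (M / \<delta>)))"
    using pair_gauss_vec_dotp_tail[OF G.prob_space_axioms sd(2) ln0(2), of "dm P" "\<lambda>_. sig P"] by simp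
  then have "holds_with_failure (?G \<Otimes>\<^sub>M ?H) (2 * (\<delta> / M)) (\<lambda>x. \<bar>dotp (dm P) (snd x) (sig P)\<bar> \<le>
      sd_init P * vnorm (dm P) (sig P) * sqrt (2 * ln (M / \<delta>)))"
    using \<delta> NM by (subst (asm) exp_ln) auto
  from training_law_noise_init[OF sd ns0 _ _ this]
  have "holds_with_failure ?T (2 * (\<delta> / M)) (\<lambda>\<omega>. \<bar>dotp (dm P) (init_weights \<omega> (fst jr) (snd jr)) (sig P)\<bar> \<le>
      sd_init P * vnorm (dm P) (sig P) * sqrt (2 * ln (M / \<delta>)))" if "jr \<in> {1, -1} \<times> {..<wd P}" for jr
    using that by (auto simp: mem_Times_iff)
  then have "holds_with_failure ?T (real (card ({1, -1 :: int} \<times> {..<wd P})) * (2 * (\<delta> / M))) (\<lambda>\<omega>. \<forall>jr\<in>{1, -1} \<times> {..<wd P}.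
      \<bar>dotp (dm P) (init_weights \<omega> (fst jr) (snd jr)) (sig P)\<bar> \<le>
      sd_init P * vnorm (dm P) (sig P) * sqrt (2 * ln (M / \<delta>)))"
    by (intro T.holds_with_failure_ball) auto
  then have init_sig: "holds_with_failure ?T (4 * \<delta>) (\<lambda>\<omega>. \<forall>jr\<in>{1, -1} \<times> {..<wd P}.
      \<bar>dotp (dm P) (init_weights \<omega> (fst jr) (snd jr)) (sig P)\<bar> \<le>
      sd_init P * vnorm (dm P) (sig P) * sqrt (2 * ln (M / \<delta>)))"
    using NM by (simp add: card_cartesian_product M_def)

  have "holds_with_failure (?G \<Otimes>\<^sub>M ?H) (2 * exp (- ln (N * M / \<delta>))) (\<lambda>x. \<bar>dotp (dm P) (snd x) (fst x)\<bar> \<le>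
      sd_init P * vnorm (dm P) (fst x) * sqrt (2 * ln (N * M / \<delta>)))"
    using pair_gauss_vec_dotp_tail[OF G.prob_space_axioms sd(2) ln0(3), of "dm P" "\<lambda>v. v"] by simp
  then have "holds_with_failure (?G \<Otimes>\<^sub>M ?H) (2 * (\<delta> / (N * M))) (\<lambda>x. \<bar>dotp (dm P) (snd x) (fst x)\<bar> \<le>
      sd_init P * vnorm (dm P) (fst x) * sqrt (2 * ln (N * M / \<delta>)))"
    using \<delta> NM by (subst (asm) exp_ln) auto
  from training_law_noise_init[OF sd _ _ _ this]
  have "holds_with_failure ?T (2 * (\<delta> / (N * M))) (\<lambda>\<omega>.
      \<bar>dotp (dm P) (init_weights \<omega> (fst (fst x)) (snd (fst x))) (noise \<omega> (snd x))\<bar> \<le>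
      sd_init P * vnorm (dm P) (noise \<omega> (snd x)) * sqrt (2 * ln (N * M / \<delta>)))"
    if "x \<in> ({1, -1} \<times> {..<wd P}) \<times> {..<ns P}" for x
    using that by (auto simp: mem_Times_iff)
  then have "holds_with_failure ?T (real (card (({1, -1 :: int} \<times> {..<wd P}) \<times> {..<ns P})) * (2 * (\<delta> / (N * M))))
      (\<lambda>\<omega>. \<forall>x\<in>({1, -1} \<times> {..<wd P}) \<times> {..<ns P}.
      \<bar>dotp (dm P) (init_weights \<omega> (fst (fst x)) (snd (fst x))) (noise \<omega> (snd x))\<bar> \<le>
      sd_init P * vnorm (dm P) (noise \<omega> (snd x)) * sqrt (2 * ln (N * M / \<delta>)))"
    by (intro T.holds_with_failure_ball) auto
  then have init_noise: "holds_with_failure ?T (4 * \<delta>) (\<lambda>\<omega>. \<forall>x\<in>({1, -1} \<times> {..<wd P}) \<times> {..<ns P}.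
      \<bar>dotp (dm P) (init_weights \<omega> (fst (fst x)) (snd (fst x))) (noise \<omega> (snd x))\<bar> \<le>
      sd_init P * vnorm (dm P) (noise \<omega> (snd x)) * sqrt (2 * ln (N * M / \<delta>)))"
    using NM by (simp add: card_cartesian_product M_def N_def)

  note combined = T.holds_with_failure_conj[OF labels T.holds_with_failure_conj[OF margins
      T.holds_with_failure_conj[OF norms T.holds_with_failure_conj[OF crosses
      T.holds_with_failure_conj[OF noise_sig T.holds_with_failure_conj[OF init_sig init_noise]]]]]]
  show ?thesis
  proof (rule holds_with_failure_mono[OF combined], goal_cases)
    case 1
    then show ?case by (simp add: \<delta>_def)
  next
    case (2 \<omega>)
    note h = conjunct1[OF 2] conjunct2[OF 2, THEN conjunct1] conjunct2[OF 2, THEN conjunct2, THEN conjunct1]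
      conjunct2[OF 2, THEN conjunct2, THEN conjunct2, THEN conjunct1]
      conjunct2[OF 2, THEN conjunct2, THEN conjunct2, THEN conjunct2, THEN conjunct1]
      conjunct2[OF 2, THEN conjunct2, THEN conjunct2, THEN conjunct2, THEN conjunct2, THEN conjunct1]
      conjunct2[OF 2, THEN conjunct2, THEN conjunct2, THEN conjunct2, THEN conjunct2, THEN conjunct2]
    show ?case
      unfolding typical_def Let_def
    proof (intro conjI allI ballI impI, goal_cases)
      case (1 i) then show ?case using h(1) unfolding true_label_def mem_Times_iff Ball_def lessThan_iff by blast
    next
      case (2 i) then show ?case using h(1) unfolding obs_label_def mem_Times_iff Ball_def lessThan_iff by blast
    next
      case (3 q) then show ?case using h(2) by (auto simp: true_label_def obs_label_def)
    next
      case (4 i) then show ?case using h(3) by (auto simp: not_less)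
    next
      case (5 i) then show ?case using h(3) by (auto simp: not_less)
    next
      case (6 i i') then show ?case using h(4)[THEN bspec, of "(i, i')"] by (simp add: N_def \<delta>_def)
    next
      case (7 i) then show ?case using h(5) by (simp add: N_def \<delta>_def)
    next
      case (8 j r) then show ?case using h(6)[THEN bspec, of "(j, r)"] by (simp add: M_def \<delta>_def)
    next
      case (9 j r i) then show ?case using h(7)[THEN bspec, of "((j, r), i)"] by (simp add: N_def M_def \<delta>_def)
    qed
  qed
qed

section \<open>The early stage of gradient descent\<close>

lemma dotp_commute: "dotp d u v = dotp d v u"
  by (simp add: dotp_def mult.commute)

lemma dotp_scaleR_right: "dotp d u (\<lambda>k. a * v k) = a * dotp d u v"
  by (simp add: dotp_def sum_distrib_left mult_ac)

lemma dotp_combination: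
  "dotp d (\<lambda>k. w k + a * u k / b + (\<Sum>i<n. c i * x i k / q i)) v =
    dotp d w v + a / b * dotp d u v + (\<Sum>i<n. c i / q i * dotp d (x i) v)"
proof -
  have "(\<Sum>k<d. (\<Sum>i<n. c i * x i k / q i) * v k) = (\<Sum>i<n. c i / q i * (\<Sum>k<d. x i k * v k))"
    unfolding sum_distrib_left sum_distrib_right by (subst sum.swap) (simp add: mult_ac)
  then show ?thesis
    by (simp add: dotp_def ring_distribs sum.distrib sum_distrib_left mult_ac)
qed

text \<open>The left side is even in \<open>z\<close>, and for \<open>z \<ge> 0\<close> the chain
  \<open>1 - z \<le> exp (- z) \<le> 2 / (1 + exp z)\<close> suffices.\<close>

lemma logistic_near_half:
  fixes z :: real
  shows "\<bar>1 / (1 + exp z) - 1 / 2\<bar> \<le> \<bar>z\<bar> / 2"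
proof -
  have pos: "1 / (1 + exp z) - 1 / 2 \<le> 0" "- z / 2 \<le> 1 / (1 + exp z) - 1 / 2" if "z \<ge> 0" for z :: real
  proof -
    show "1 / (1 + exp z) - 1 / 2 \<le> 0"
      using that exp_gt_zero[of z] one_le_exp_iff[of z] by (auto simp add: field_simps simp del: one_le_exp_iff)
    have "1 - z \<le> exp (- z)" using exp_ge_add_one_self[of "- z"] by simp
    also have "\<dots> \<le> 2 / (1 + exp z)"
      using that by (simp add: exp_minus field_simps add_pos_pos)
    finally show "- z / 2 \<le> 1 / (1 + exp z) - 1 / 2" by simp
  qed
  have "1 / (1 + exp (- z)) - 1 / 2 = - (1 / (1 + exp z) - 1 / 2)"
  proof -
    have "1 + exp z > 0" by (simp add: add_pos_pos)
    moreover from this have "1 / (1 + exp (- z)) = exp z / (1 + exp z)"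
      by (simp add: exp_minus field_simps)
    moreover have "exp z / (1 + exp z) + 1 / (1 + exp z) = 1"
      using calculation(1) by (simp add: add_divide_distrib[symmetric] add.commute)
    ultimately show ?thesis by simp
  qed
  then show ?thesis
    using pos[of z] pos[of "- z"] by (cases "z \<ge> 0") (auto simp: abs_real_def)
qed

text \<open>The interface between probability and dynamics: from here on the outcome is fixed. One
  constant \<open>e\<close> measures all cross terms, with \<open>e / ns P\<close> where a sum over
  samples follows. Products of noise and signal are bounded in two scales, since they are divided by
  the squared noise norm in projections onto the signal and by the squared signal norm in
  projections onto the noise.\<close>

locale controlled_outcome =
  fixes P :: setting and \<omega> :: outcome and e p \<kappa> :: real
  assumes pos: "0 < ns P" "0 < wd P" "0 < dm P" "vnorm (dm P) (sig P) > 0" "0 < sd_noise P" "0 < lrate P"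
    and p: "0 < p" "p \<le> 1/4"
    and e: "0 < e" "6 * e \<le> p / (4 * (\<kappa> + 4))"
    and snr: "12 / p \<le> real (ns P) * (SNR P)\<^sup>2" "real (ns P) * (SNR P)\<^sup>2 \<le> \<kappa>"
    and true_label: "\<And>i. i < ns P \<Longrightarrow> true_label \<omega> i \<in> {1, -1}"
    and obs_label: "\<And>i. i < ns P \<Longrightarrow> obs_label \<omega> i \<in> {1, -1}"
    and margin: "\<And>q. q \<in> {1, -1} \<Longrightarrow>
      real (ns P) * p \<le> (\<Sum>i<ns P. class_margin q (true_label \<omega> i, obs_label \<omega> i))"
    and noise_lower: "\<And>i. i < ns P \<Longrightarrow> (sd_noise P)\<^sup>2 * dm P / 4 \<le> (vnorm (dm P) (noise \<omega> i))\<^sup>2"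
    and noise_upper: "\<And>i. i < ns P \<Longrightarrow> (vnorm (dm P) (noise \<omega> i))\<^sup>2 \<le> 2 * ((sd_noise P)\<^sup>2 * dm P)"
    and noise_noise: "\<And>i i'. i < ns P \<Longrightarrow> i' < ns P \<Longrightarrow> i \<noteq> i' \<Longrightarrow>
      \<bar>dotp (dm P) (noise \<omega> i') (noise \<omega> i)\<bar> \<le> e / ns P * (vnorm (dm P) (noise \<omega> i))\<^sup>2"
    and noise_sig: "\<And>i. i < ns P \<Longrightarrow> \<bar>dotp (dm P) (noise \<omega> i) (sig P)\<bar> \<le> e * (vnorm (dm P) (sig P))\<^sup>2"
    and noise_sig': "\<And>i. i < ns P \<Longrightarrow>
      \<bar>dotp (dm P) (noise \<omega> i) (sig P)\<bar> \<le> e / ns P * (vnorm (dm P) (noise \<omega> i))\<^sup>2"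
    and init_sig: "\<And>j r. j \<in> {1, -1} \<Longrightarrow> r < wd P \<Longrightarrow> \<bar>dotp (dm P) (init_weights \<omega> j r) (sig P)\<bar> \<le> e"
    and init_noise: "\<And>j r i. j \<in> {1, -1} \<Longrightarrow> r < wd P \<Longrightarrow> i < ns P \<Longrightarrow>
      \<bar>dotp (dm P) (init_weights \<omega> j r) (noise \<omega> i)\<bar> \<le> e"
begin

abbreviation "n \<equiv> real (ns P)"
abbreviation "m \<equiv> real (wd P)"
abbreviation "\<mu>2 \<equiv> (vnorm (dm P) (sig P))\<^sup>2"
abbreviation "\<xi>2 i \<equiv> (vnorm (dm P) (noise \<omega> i))\<^sup>2"
abbreviation "dot \<equiv> dotp (dm P)"
abbreviation "y i \<equiv> real_of_int (true_label \<omega> i)"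
abbreviation "y' i \<equiv> real_of_int (obs_label \<omega> i)"

definition h :: real where "h = lrate P * (sd_noise P)\<^sup>2 * dm P / (n * m)"
definition snr2 :: real where "snr2 = n * (SNR P)\<^sup>2"
text \<open>Makes \<open>c * (\<kappa> + 4) = p / 4\<close>, the share of the output bound
  \<open>p / 2\<close> that learning may use up; initialization and cross terms take the
  rest.\<close>

definition c :: real where "c = p / (4 * (\<kappa> + 4))"

definition weight :: "nat \<Rightarrow> nat \<Rightarrow> real" where
  "weight t i = 1 / (1 + exp (y' i * net_at P \<omega> t i))"

text \<open>The gradient updates summed from the start, so that bounds follow term by term;
  \<open>decomp_coeffs_eq\<close> identifies these sums with the specified coefficients. The factor
  \<open>j\<close> occurs only in \<open>rcoef\<close>, because the decomposition itself puts it in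
  front of \<gamma>.\<close>

definition gcoef :: "nat \<Rightarrow> int \<Rightarrow> nat \<Rightarrow> real" where
  "gcoef t j r = (\<Sum>s<t. lrate P * \<mu>2 / (n * m) *
     (\<Sum>i<ns P. weight s i * y' i * y i * relu' (y i * dot (iterate P \<omega> s j r) (sig P))))"

definition rcoef :: "nat \<Rightarrow> int \<Rightarrow> nat \<Rightarrow> nat \<Rightarrow> real" where
  "rcoef t j r i = (if i < ns P then
     (\<Sum>s<t. lrate P * \<xi>2 i / (n * m) * (weight s i * y' i * of_int j * relu' (dot (iterate P \<omega> s j r) (noise \<omega> i))))
     else 0)"

lemma h_pos: "h > 0" and mu_pos: "\<mu>2 > 0" and n_pos: "n > 0" and m_pos: "m > 0"
  using pos by (auto simp: h_def)

lemma h_time_unit: "h = 1 / time_unit P"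
  by (simp add: h_def time_unit_def)

lemma noise_pos: "i < ns P \<Longrightarrow> \<xi>2 i > 0"
  using noise_lower[of i] pos by (smt (verit) divide_pos_pos mult_pos_pos of_nat_0_less_iff zero_less_power)

text \<open>Measures signal steps in units of noise steps; this is how
  \<open>n * SNR\<^sup>2\<close> enters the dynamics.\<close>

lemma signal_rate: "lrate P * \<mu>2 / (n * m) = h * snr2 / n"
  using pos by (simp add: h_def snr2_def SNR_def power_divide power_mult_distrib field_simps)

lemma kappa: "48 \<le> 12 / p" "12 / p \<le> snr2" "snr2 \<le> \<kappa>" "\<kappa> \<ge> 48" "snr2 \<ge> 48"
proof -
  show "48 \<le> 12 / p" using p by (simp add: field_simps)
  with snr show "12 / p \<le> snr2" "snr2 \<le> \<kappa>" "\<kappa> \<ge> 48" "snr2 \<ge> 48" by (auto simp: snr2_def)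
qed

lemma c_bounds: "0 < c" "c * (\<kappa> + 4) = p / 4" "c \<le> 1/16" "6 * e \<le> c"
proof -
  have "\<kappa> + 4 > 0" using kappa by simp
  then show "0 < c" "c * (\<kappa> + 4) = p / 4" using p by (simp_all add: c_def del: distrib_left_numeral)
  have "c * 1 \<le> c * (\<kappa> + 4)" using \<open>0 < c\<close> kappa by (intro mult_left_mono) auto
  with \<open>c * (\<kappa> + 4) = p / 4\<close> p show "c \<le> 1/16" by simp
  show "6 * e \<le> c" using e by (simp add: c_def)
qed

lemma e_kappa: "e * (\<kappa> + 4) \<le> 1/96" "e \<le> 1/96"
proof -
  have "6 * e * (\<kappa> + 4) \<le> c * (\<kappa> + 4)"
    using c_bounds kappa by (intro mult_right_mono) auto
  then show "e * (\<kappa> + 4) \<le> 1/96" using c_bounds p by simp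
  show "e \<le> 1/96" using c_bounds by simp
qed

section \<open>The decomposition along gradient descent\<close>

lemma sample_dots:
  "dot w (fst (sample P \<omega> i)) = y i * dot w (sig P)" "dot w (snd (sample P \<omega> i)) = dot w (noise \<omega> i)"
  by (simp_all add: sample_def dotp_scaleR_right)

lemma decomposition:
  "iterate P \<omega> t j r k = init_weights \<omega> j r k + of_int j * gcoef t j r * sig P k / \<mu>2
     + (\<Sum>i<ns P. rcoef t j r i * noise \<omega> i k / \<xi>2 i)"
proof (induction t)
  case 0
  then show ?case by (simp add: iterate_def gcoef_def rcoef_def)
next
  case (Suc t)
  let ?W = "iterate P \<omega> t"
  let ?a = "\<lambda>i. relu' (y i * dot (?W j r) (sig P))" and ?b = "\<lambda>i. relu' (dot (?W j r) (noise \<omega> i))"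
  have "iterate P \<omega> (Suc t) j r k = ?W j r k -
      lrate P * loss_grad (dm P) (ns P) (wd P) (sample P \<omega>) (obs_label \<omega>) ?W j r k"
    by (simp add: iterate_def)
  also have "loss_grad (dm P) (ns P) (wd P) (sample P \<omega>) (obs_label \<omega>) ?W j r k
      = 1 / n * (\<Sum>i<ns P. - weight t i * y' i * (of_int j / m * (?a i * (y i * sig P k) + ?b i * noise \<omega> i k)))"
    unfolding loss_grad_def sample_dots by (simp add: weight_def net_at_def sample_def)
  finally have step: "iterate P \<omega> (Suc t) j r k = ?W j r k +
      lrate P / n * (\<Sum>i<ns P. weight t i * y' i * (of_int j / m * (?a i * (y i * sig P k) + ?b i * noise \<omega> i k)))"
    by (simp add: sum_negf)
  have "(\<Sum>i<ns P. weight t i * y' i * (of_int j / m * (?a i * (y i * sig P k) + ?b i * noise \<omega> i k)))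
     = of_int j / m * (\<Sum>i<ns P. weight t i * y' i * y i * ?a i) * sig P k
      + (\<Sum>i<ns P. of_int j / m * (weight t i * y' i * ?b i * noise \<omega> i k))"
    by (simp add: sum_distrib_left sum_distrib_right sum.distrib algebra_simps)
  then have "iterate P \<omega> (Suc t) j r k = ?W j r k
      + of_int j * (lrate P / (n * m) * (\<Sum>i<ns P. weight t i * y' i * y i * ?a i)) * sig P k
      + (\<Sum>i<ns P. lrate P / (n * m) * (weight t i * y' i * of_int j * ?b i) * noise \<omega> i k)"
    by (simp add: step sum_distrib_left ring_distribs mult_ac)
  moreover have "gcoef (Suc t) j r / \<mu>2 = gcoef t j r / \<mu>2 + lrate P / (n * m) * (\<Sum>i<ns P. weight t i * y' i * y i * ?a i)"
    using mu_pos by (simp add: gcoef_def add_divide_distrib)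
  then have "of_int j * gcoef (Suc t) j r * sig P k / \<mu>2 = of_int j * gcoef t j r * sig P k / \<mu>2 +
      of_int j * (lrate P / (n * m) * (\<Sum>i<ns P. weight t i * y' i * y i * ?a i)) * sig P k"
  proof -
    assume eq: "gcoef (Suc t) j r / \<mu>2 = gcoef t j r / \<mu>2 + lrate P / (n * m) * (\<Sum>i<ns P. weight t i * y' i * y i * ?a i)"
    have "of_int j * gcoef (Suc t) j r * sig P k / \<mu>2 = of_int j * (gcoef (Suc t) j r / \<mu>2) * sig P k"
      by simp
    then show ?thesis
      unfolding eq by (simp add: ring_distribs)
  qed
  moreover have "rcoef (Suc t) j r i * noise \<omega> i k / \<xi>2 i = rcoef t j r i * noise \<omega> i k / \<xi>2 i +
      lrate P / (n * m) * (weight t i * y' i * of_int j * ?b i) * noise \<omega> i k" if "i < ns P" for i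
    using noise_pos[OF that] that by (simp add: rcoef_def field_simps)
  then have "(\<Sum>i<ns P. rcoef (Suc t) j r i * noise \<omega> i k / \<xi>2 i) = (\<Sum>i<ns P. rcoef t j r i * noise \<omega> i k / \<xi>2 i) +
      (\<Sum>i<ns P. lrate P / (n * m) * (weight t i * y' i * of_int j * ?b i) * noise \<omega> i k)"
    by (simp add: sum.distrib)
  ultimately show ?case
    using Suc.IH by simp
qed

text \<open>Near orthogonality: projecting onto one vector reads off its own coefficient. The noise
  vectors disturb it by at most n terms of size \<open>e * B / n\<close>, the signal by
  \<open>e * \<bar>a\<bar>\<close>. Arbitrary \<open>w\<close>, \<open>a\<close>, \<open>b\<close>
  serve both the iterates and the uniqueness proof.\<close>

lemma combination_dots:
  fixes w :: rvec and a B :: real and b :: "nat \<Rightarrow> real"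
  assumes b: "\<And>i. i < ns P \<Longrightarrow> \<bar>b i\<bar> \<le> B"
  defines "v \<equiv> \<lambda>k. w k + a * sig P k / \<mu>2 + (\<Sum>i<ns P. b i * noise \<omega> i k / \<xi>2 i)"
  shows "\<bar>dot v (sig P) - (dot w (sig P) + a)\<bar> \<le> e * B"
    and "l < ns P \<Longrightarrow> \<bar>dot v (noise \<omega> l) - (dot w (noise \<omega> l) + b l)\<bar> \<le> e * \<bar>a\<bar> + e * B"
proof -
  have B: "B \<ge> 0" using b[of 0] pos by (auto intro: order_trans[OF abs_ge_zero])
  have term_le: "\<bar>b i / \<xi>2 i * q\<bar> \<le> e * B / n" if "i < ns P" "\<bar>q\<bar> \<le> e / n * \<xi>2 i" for i q
  proof -
    have "\<bar>b i / \<xi>2 i * q\<bar> = \<bar>b i\<bar> * (\<bar>q\<bar> / \<xi>2 i)"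
      using noise_pos[OF that(1)] by (simp add: abs_mult)
    also have "\<dots> \<le> B * (e / n)"
      using b[OF that(1)] B noise_pos[OF that(1)] that(2) by (intro mult_mono) (auto simp: field_simps)
    finally show ?thesis by (simp add: mult.commute)
  qed
  have sum_le: "\<bar>\<Sum>i\<in>I. f i\<bar> \<le> e * B" if "I \<subseteq> {..<ns P}" "\<And>i. i \<in> I \<Longrightarrow> \<bar>f i\<bar> \<le> e * B / n" for f :: "nat \<Rightarrow> real" and I
  proof -
    have "\<bar>\<Sum>i\<in>I. f i\<bar> \<le> (\<Sum>i\<in>I. e * B / n)"
      using that by (intro order_trans[OF sum_abs] sum_mono) auto
    also have "\<dots> \<le> (\<Sum>i<ns P. e * B / n)"
      using that e B by (intro sum_mono2) auto
    finally show ?thesis using pos by simp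
  qed
  show "\<bar>dot v (sig P) - (dot w (sig P) + a)\<bar> \<le> e * B"
  proof -
    have "dot (sig P) (sig P) = \<mu>2" by (simp add: vnorm_sq)
    then have "dot v (sig P) - (dot w (sig P) + a) = (\<Sum>i<ns P. b i / \<xi>2 i * dot (noise \<omega> i) (sig P))"
      unfolding v_def dotp_combination using mu_pos by simp
    also have "\<bar>\<dots>\<bar> \<le> e * B"
      by (intro sum_le term_le noise_sig') auto
    finally show ?thesis .
  qed
  assume l: "l < ns P"
  have "dot (noise \<omega> l) (noise \<omega> l) = \<xi>2 l" by (simp add: vnorm_sq)
  then have "(\<Sum>i<ns P. b i / \<xi>2 i * dot (noise \<omega> i) (noise \<omega> l))
      = b l + (\<Sum>i\<in>{..<ns P} - {l}. b i / \<xi>2 i * dot (noise \<omega> i) (noise \<omega> l))"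
    using l noise_pos[OF l] by (subst sum.remove[of _ l]) auto
  then have "dot v (noise \<omega> l) - (dot w (noise \<omega> l) + b l)
      = a / \<mu>2 * dot (sig P) (noise \<omega> l) + (\<Sum>i\<in>{..<ns P} - {l}. b i / \<xi>2 i * dot (noise \<omega> i) (noise \<omega> l))"
    unfolding v_def dotp_combination by simp
  moreover have "\<bar>\<Sum>i\<in>{..<ns P} - {l}. b i / \<xi>2 i * dot (noise \<omega> i) (noise \<omega> l)\<bar> \<le> e * B"
  proof (intro sum_le term_le)
    fix i assume "i \<in> {..<ns P} - {l}"
    then show "\<bar>dot (noise \<omega> i) (noise \<omega> l)\<bar> \<le> e / n * \<xi>2 i"
      using noise_noise[of i l] l by (subst dotp_commute) auto
  qed auto
  moreover have "\<bar>a / \<mu>2 * dot (sig P) (noise \<omega> l)\<bar> = \<bar>a\<bar> * (\<bar>dot (noise \<omega> l) (sig P)\<bar> / \<mu>2)"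
    by (simp add: abs_mult dotp_commute)
  moreover have "\<bar>a\<bar> * (\<bar>dot (noise \<omega> l) (sig P)\<bar> / \<mu>2) \<le> \<bar>a\<bar> * e"
    using noise_sig[OF l] mu_pos by (intro mult_left_mono) (auto simp: field_simps)
  ultimately show "\<bar>dot v (noise \<omega> l) - (dot w (noise \<omega> l) + b l)\<bar> \<le> e * \<bar>a\<bar> + e * B"
    unfolding mult.commute[of e "\<bar>a\<bar>"] by linarith
qed

text \<open>Linear independence by diagonal dominance of the Gram matrix: a largest coefficient is bounded by
  a small multiple of itself.\<close>

lemma combination_zero:
  fixes a :: real and b :: "nat \<Rightarrow> real"
  assumes zero: "\<And>k. k < dm P \<Longrightarrow> a * sig P k / \<mu>2 + (\<Sum>i<ns P. b i * noise \<omega> i k / \<xi>2 i) = 0"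
  shows "a = 0" and "\<And>i. i < ns P \<Longrightarrow> b i = 0"
proof -
  define B where "B = Max ((\<lambda>i. \<bar>b i\<bar>) ` {..<ns P})"
  have le: "\<bar>b i\<bar> \<le> B" if "i < ns P" for i
    using that by (simp add: B_def)
  have "B \<in> (\<lambda>i. \<bar>b i\<bar>) ` {..<ns P}"
    unfolding B_def using pos by (intro Max_in) auto
  then obtain l where l: "l < ns P" "B = \<bar>b l\<bar>" by auto
  have "dot (\<lambda>k. (\<lambda>_. 0) k + a * sig P k / \<mu>2 + (\<Sum>i<ns P. b i * noise \<omega> i k / \<xi>2 i)) u = 0" for u
    using zero by (simp add: dotp_def)
  moreover have "dot (\<lambda>_. 0) u = 0" for u by (simp add: dotp_def)
  ultimately have "\<bar>a\<bar> \<le> e * B" "\<bar>b l\<bar> \<le> e * \<bar>a\<bar> + e * B"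
    using combination_dots(1)[of b B "\<lambda>_. 0" a] combination_dots(2)[of b B l "\<lambda>_. 0" a] le l by auto
  moreover have "e * \<bar>a\<bar> \<le> 1 * \<bar>a\<bar>" "e * B \<le> 1/96 * B"
    using e_kappa l by (intro mult_right_mono; auto)+
  ultimately have "B \<le> 0" "\<bar>a\<bar> \<le> 1/96 * B" using l by linarith+
  then show "a = 0" and "\<And>i. i < ns P \<Longrightarrow> b i = 0"
    using le l by (fastforce, fastforce)
qed

text \<open>The difference of two decompositions is a vanishing combination, in which
  \<open>j\<close> is nonzero and cancels. The normalization beyond \<open>ns P\<close> then makes
  the coefficient functions equal everywhere.\<close>

lemma decomp_coeffs_eq:
  assumes "j \<in> {1, -1}"
  shows "decomp_coeffs P \<omega> t j r = (gcoef t j r, rcoef t j r)"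
  unfolding decomp_coeffs_def
proof (rule the_equality)
  show "is_decomp P \<omega> t j r (gcoef t j r, rcoef t j r)"
    unfolding is_decomp_def using decomposition by (auto simp: rcoef_def)
  fix x assume x: "is_decomp P \<omega> t j r x"
  have "of_int j * (fst x - gcoef t j r) * sig P k / \<mu>2 + (\<Sum>i<ns P. (snd x i - rcoef t j r i) * noise \<omega> i k / \<xi>2 i) = 0"
    if "k < dm P" for k
    using x that decomposition[of t j r k]
    by (simp add: is_decomp_def algebra_simps diff_divide_distrib sum_subtractf)
  from combination_zero[OF this] have "fst x = gcoef t j r" "\<And>i. i < ns P \<Longrightarrow> snd x i = rcoef t j r i"
    using assms by auto
  moreover have "snd x i = rcoef t j r i" if "i \<ge> ns P" for i
    using that x by (simp add: is_decomp_def rcoef_def)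
  ultimately show "x = (gcoef t j r, rcoef t j r)"
    by (auto simp: prod_eq_iff fun_eq_iff not_less intro: le_less_linear[THEN disjE])
qed

section \<open>Linear bounds at all times\<close>

lemma weight_bounds: "0 < weight t i" "weight t i \<le> 1"
  by (auto simp: weight_def add_pos_pos)

lemma labels_abs [simp]: "i < ns P \<Longrightarrow> \<bar>y i\<bar> = 1" "i < ns P \<Longrightarrow> \<bar>y' i\<bar> = 1"
  using true_label[of i] obs_label[of i] by auto

lemma relu'_bounds: "0 \<le> relu' z" "relu' z \<le> 1"
  by (auto simp: relu'_def)

text \<open>Only \<open>weight s i \<le> 1\<close> enters, so nothing about the outputs is
  presupposed.\<close>

lemma gcoef_abs_le: "\<bar>gcoef t j r\<bar> \<le> t * h * \<kappa>"
proof -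
  have "\<bar>\<Sum>i<ns P. weight s i * y' i * y i * relu' (y i * q)\<bar> \<le> n" for s q
  proof -
    have "\<bar>\<Sum>i<ns P. weight s i * y' i * y i * relu' (y i * q)\<bar>
        \<le> (\<Sum>i<ns P. \<bar>weight s i * y' i * y i * relu' (y i * q)\<bar>)"
      by (rule sum_abs)
    also have "\<dots> \<le> (\<Sum>i<ns P. 1)"
      using weight_bounds relu'_bounds
      by (intro sum_mono) (auto simp: abs_mult less_imp_le intro!: mult_le_one)
    finally show ?thesis by simp
  qed
  moreover have "\<bar>h * snr2 / n * q\<bar> = h * snr2 / n * \<bar>q\<bar>" for q
    using h_pos kappa n_pos by (simp add: abs_mult)
  moreover have "0 \<le> h * snr2 / n"
    using h_pos kappa n_pos by simp
  ultimately have "\<bar>gcoef t j r\<bar> \<le> (\<Sum>s<t. h * snr2 / n * n)"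
    unfolding gcoef_def signal_rate
    by (intro order_trans[OF sum_abs] sum_mono) (simp only: mult_left_mono)
  also have "\<dots> = t * h * snr2" using pos by simp
  also have "\<dots> \<le> t * h * \<kappa>" using kappa h_pos by (intro mult_left_mono) auto
  finally show ?thesis .
qed

text \<open>The 2 stems from \<open>noise_upper\<close>; weights and activations contribute a factor
  of at most 1.\<close>

lemma rcoef_abs_le:
  assumes "j \<in> {1, -1}"
  shows "\<bar>rcoef t j r i\<bar> \<le> 2 * (t * h)"
proof (cases "i < ns P")
  case True
  have rate: "lrate P * \<xi>2 i / (n * m) \<le> 2 * h"
    using noise_upper[OF True] pos by (simp add: h_def field_simps)
  have "\<bar>lrate P * \<xi>2 i / (n * m) * (weight s i * y' i * of_int j * relu' q)\<bar> \<le> 2 * h" for s q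
  proof -
    have "\<bar>weight s i * y' i * of_int j * relu' q\<bar> \<le> 1"
      using weight_bounds[of s i] relu'_bounds[of q] assms True
      by (auto simp: abs_mult less_imp_le intro!: mult_le_one)
    then have "lrate P * \<xi>2 i / (n * m) * \<bar>weight s i * y' i * of_int j * relu' q\<bar> \<le> 2 * h * 1"
      using rate h_pos by (intro mult_mono) auto
    then show ?thesis using pos by (simp add: abs_mult)
  qed
  then have "\<bar>rcoef t j r i\<bar> \<le> (\<Sum>s<t. 2 * h)"
    using True unfolding rcoef_def by (simp only: if_True) (intro order_trans[OF sum_abs] sum_mono)
  then show ?thesis by simp
next
  case False
  then show ?thesis using h_pos by (simp add: rcoef_def)
qed

lemma iterate_sig:
  assumes "j \<in> {1, -1}"
  shows "\<bar>dot (iterate P \<omega> t j r) (sig P) - (dot (init_weights \<omega> j r) (sig P) + of_int j * gcoef t j r)\<bar>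
    \<le> e * (2 * (t * h))"
  using combination_dots(1)[of "rcoef t j r" "2 * (t * h)" "init_weights \<omega> j r" "of_int j * gcoef t j r"]
    rcoef_abs_le[OF assms]
  by (simp add: decomposition[abs_def])

lemma iterate_noise:
  assumes "j \<in> {1, -1}" "i < ns P"
  shows "\<bar>dot (iterate P \<omega> t j r) (noise \<omega> i) - (dot (init_weights \<omega> j r) (noise \<omega> i) + rcoef t j r i)\<bar>
    \<le> e * (t * h * (\<kappa> + 2))"
proof -
  have "\<bar>dot (iterate P \<omega> t j r) (noise \<omega> i) - (dot (init_weights \<omega> j r) (noise \<omega> i) + rcoef t j r i)\<bar>
     \<le> e * \<bar>of_int j * gcoef t j r\<bar> + e * (2 * (t * h))"
    using combination_dots(2)[of "rcoef t j r" "2 * (t * h)" i "init_weights \<omega> j r" "of_int j * gcoef t j r"]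
      rcoef_abs_le[OF assms(1)] assms(2)
    by (simp add: decomposition[abs_def])
  also have "\<bar>of_int j * gcoef t j r\<bar> = \<bar>gcoef t j r\<bar>"
    using assms by (auto simp: abs_mult)
  also have "e * \<bar>gcoef t j r\<bar> + e * (2 * (t * h)) \<le> e * (t * h * \<kappa>) + e * (2 * (t * h))"
    using gcoef_abs_le e by (intro add_mono mult_left_mono) auto
  finally show ?thesis by (simp add: algebra_simps)
qed

section \<open>Dynamics up to rescaled time \<open>c\<close>\<close>

lemma net_small:
  assumes t: "t * h \<le> c" and i: "i < ns P"
  shows "\<bar>net_at P \<omega> t i\<bar> \<le> p / 2"
proof -
  define \<theta> where "\<theta> = t * h"
  have \<theta>: "0 \<le> \<theta>" "\<theta> \<le> c" using t h_pos by (simp_all add: \<theta>_def)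
  \<comment> \<open>Bounds the two preactivations of one neuron together: initialization, signal,
    memorized noise and cross terms. Both outputs lie between 0 and \<open>B\<close>, so their
    difference has modulus at most \<open>B\<close>, not \<open>2 * B\<close>.\<close>
  define B where "B = 2 * e + \<theta> * \<kappa> + e * (2 * \<theta>) + 2 * \<theta> + e * (\<theta> * (\<kappa> + 2))"
  have F: "0 \<le> F_out (dm P) (wd P) (iterate P \<omega> t) j (sample P \<omega> i) \<and>
      F_out (dm P) (wd P) (iterate P \<omega> t) j (sample P \<omega> i) \<le> B" if j: "j \<in> {1, -1}" for j
  proof -
    have "relu (y i * dot (iterate P \<omega> t j r) (sig P)) + relu (dot (iterate P \<omega> t j r) (noise \<omega> i)) \<le> B"
      if r: "r < wd P" for r
    proof -
      have "\<bar>of_int j * gcoef t j r\<bar> = \<bar>gcoef t j r\<bar>"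
        using j by (auto simp: abs_mult)
      then have "\<bar>y i * dot (iterate P \<omega> t j r) (sig P)\<bar> \<le> e + \<theta> * \<kappa> + e * (2 * \<theta>)"
        using iterate_sig[OF j, of t r] init_sig[OF j r] gcoef_abs_le[of t j r] i
        unfolding abs_mult[of "y i"] labels_abs(1)[OF i] \<theta>_def by linarith
      moreover have "\<bar>dot (iterate P \<omega> t j r) (noise \<omega> i)\<bar> \<le> e + 2 * \<theta> + e * (\<theta> * (\<kappa> + 2))"
        using iterate_noise[OF j i, of t r] init_noise[OF j r i] rcoef_abs_le[OF j, of t r i]
        unfolding \<theta>_def by linarith
      ultimately show ?thesis by (simp add: relu_def B_def)
    qed
    then have "(\<Sum>r<wd P. relu (y i * dot (iterate P \<omega> t j r) (sig P)) + relu (dot (iterate P \<omega> t j r) (noise \<omega> i)))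
        \<le> m * B"
      using sum_bounded_above[of "{..<wd P}" _ B] by simp
    moreover have "0 \<le> (\<Sum>r<wd P. relu (y i * dot (iterate P \<omega> t j r) (sig P)) + relu (dot (iterate P \<omega> t j r) (noise \<omega> i)))"
      by (intro sum_nonneg) (simp add: relu_def)
    ultimately show ?thesis
      using m_pos by (simp add: F_out_def sample_dots field_simps)
  qed
  have "B \<le> p / 2"
  proof -
    have "\<theta> * (\<kappa> + 4) \<le> c * (\<kappa> + 4)" using \<theta> kappa by (intro mult_right_mono) auto
    then have 1: "\<theta> * \<kappa> + 4 * \<theta> \<le> p / 4" using c_bounds by (simp add: algebra_simps)
    have "e * (\<theta> * (\<kappa> + 4)) \<le> 1/96 * (\<theta> * (\<kappa> + 4))"
      using e_kappa \<theta> kappa by (intro mult_right_mono) auto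
    then have "e * (2 * \<theta>) + e * (\<theta> * (\<kappa> + 2)) \<le> \<theta> * \<kappa> / 96 + \<theta> / 24"
      by (simp add: algebra_simps)
    \<comment> \<open>\<open>\<kappa> \<ge> 48\<close> gives \<open>52 * c \<le> p / 4\<close>, so
      that \<open>e \<le> c / 6\<close> is a tiny part of \<open>p\<close>.\<close>
    moreover have "c * 52 \<le> c * (\<kappa> + 4)" using kappa c_bounds by (intro mult_left_mono) auto
    then have "2 * e \<le> p / 100" using c_bounds p by linarith
    moreover have "2 * e + k + a + 2 * \<theta> + b \<le> p / 2"
      if "a + b \<le> k / 96 + \<theta> / 24" "2 * e \<le> p / 100" "k + 4 * \<theta> \<le> p / 4" for a b k :: real
      using that p \<theta> by linarith
    ultimately show ?thesis using 1 unfolding B_def by blast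
  qed
  moreover have "\<bar>net_at P \<omega> t i\<bar> \<le> B"
    using F[of 1] F[of "-1"] by (simp add: net_at_def net_def abs_le_iff)
  ultimately show ?thesis by simp
qed

lemma weight_near_half:
  assumes "t * h \<le> c" "i < ns P"
  shows "\<bar>weight t i - 1 / 2\<bar> \<le> p / 4"
  using logistic_near_half[of "y' i * net_at P \<omega> t i"] net_small[OF assms] assms(2)
  by (simp add: weight_def abs_mult)

text \<open>The sign of \<open>q\<close> decides which class activates the neuron, and either class
  has a surplus of at least \<open>n * p\<close>. At \<open>q = 0\<close> the convention
  \<open>relu' 0 = 1\<close> activates both, and the surpluses add.\<close>

lemma class_balance:
  "n * p \<le> (\<Sum>i<ns P. y' i * y i * relu' (y i * q))"
proof -
  have margin': "n * p \<le> (\<Sum>i<ns P. of_bool (true_label \<omega> i = s) * y' i * y i)" if "s \<in> {1, -1}" for s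
    using margin[OF that] by (simp add: class_margin_def)
  consider "q > 0" | "q < 0" | "q = 0" by linarith
  then show ?thesis
  proof cases
    case 1
    then have "y' i * y i * relu' (y i * q) = of_bool (true_label \<omega> i = 1) * y' i * y i" if "i < ns P" for i
      using true_label[OF that] by (auto simp: relu'_def)
    then have "(\<Sum>i<ns P. y' i * y i * relu' (y i * q)) = (\<Sum>i<ns P. of_bool (true_label \<omega> i = 1) * y' i * y i)"
      by (intro sum.cong) (auto simp only: lessThan_iff)
    then show ?thesis using margin'[of 1] by simp
  next
    case 2
    then have "y' i * y i * relu' (y i * q) = of_bool (true_label \<omega> i = -1) * y' i * y i" if "i < ns P" for i
      using true_label[OF that] by (auto simp: relu'_def)
    then have "(\<Sum>i<ns P. y' i * y i * relu' (y i * q)) = (\<Sum>i<ns P. of_bool (true_label \<omega> i = -1) * y' i * y i)"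
      by (intro sum.cong) (auto simp only: lessThan_iff)
    then show ?thesis using margin'[of "-1"] by simp
  next
    case 3
    then have "y' i * y i * relu' (y i * q) = of_bool (true_label \<omega> i = 1) * y' i * y i +
        of_bool (true_label \<omega> i = -1) * y' i * y i" if "i < ns P" for i
      using true_label[OF that] by (auto simp: relu'_def)
    then have "(\<Sum>i<ns P. y' i * y i * relu' (y i * q)) = (\<Sum>i<ns P. of_bool (true_label \<omega> i = 1) * y' i * y i) +
        (\<Sum>i<ns P. of_bool (true_label \<omega> i = -1) * y' i * y i)"
      unfolding sum.distrib[symmetric] by (intro sum.cong) (auto simp only: lessThan_iff)
    moreover have "0 \<le> n * p" using p by simp
    ultimately show ?thesis using margin'[of 1] margin'[of "-1"] by simp
  qed
qed

text \<open>Replacing each weight by \<open>1/2\<close> costs at most \<open>p / 4\<close> per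
  sample, which leaves \<open>n * p / 2 - n * p / 4\<close>.\<close>

lemma weighted_class_balance:
  assumes t: "t * h \<le> c"
  shows "n * p / 4 \<le> (\<Sum>i<ns P. weight t i * y' i * y i * relu' (y i * q))"
proof -
  let ?X = "\<lambda>i. y' i * y i * relu' (y i * q)"
  have "1/2 * ?X i - p / 4 \<le> weight t i * y' i * y i * relu' (y i * q)" if i: "i < ns P" for i
  proof -
    have "\<bar>(weight t i - 1/2) * ?X i\<bar> \<le> p / 4 * 1"
      using weight_near_half[OF t i] i p relu'_bounds[of "y i * q"]
      unfolding abs_mult by (intro mult_mono) auto
    moreover have "(weight t i - 1/2) * ?X i = weight t i * y' i * y i * relu' (y i * q) - 1/2 * ?X i"
      by (simp add: left_diff_distrib mult.assoc)
    ultimately show ?thesis by linarith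
  qed
  then have "(\<Sum>i<ns P. 1/2 * ?X i - p / 4) \<le> (\<Sum>i<ns P. weight t i * y' i * y i * relu' (y i * q))"
    by (intro sum_mono) auto
  then show ?thesis
    using class_balance[of q] by (simp add: sum_subtractf flip: sum_divide_distrib)
qed

lemma step_time_mono: "s \<le> t \<Longrightarrow> t * h \<le> c \<Longrightarrow> s * h \<le> c"
  using h_pos by (meson less_imp_le mult_right_mono of_nat_le_iff order_trans)

text \<open>The threshold \<open>12 / p\<close> in the locale is exactly what makes
  \<open>snr2 * p / 4\<close> at least 3.\<close>

lemma gcoef_lower:
  assumes t: "t * h \<le> c"
  shows "3 * (t * h) \<le> gcoef t j r"
proof -
  have "3 \<le> snr2 * p / 4" using kappa(2) p by (simp add: field_simps)
  then have "h * 3 \<le> h * (snr2 * p / 4)" using h_pos by (intro mult_left_mono) auto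
  also have "\<dots> = h * snr2 / n * (n * p / 4)" using n_pos by simp
  finally have rate: "3 * h \<le> h * snr2 / n * (n * p / 4)" by simp
  have "(\<Sum>s<t. 3 * h) \<le> gcoef t j r"
    unfolding gcoef_def signal_rate
  proof (rule sum_mono)
    fix s assume "s \<in> {..<t}"
    then have "s * h \<le> c" using t step_time_mono[of s t] by simp
    then have "h * snr2 / n * (n * p / 4) \<le> h * snr2 / n *
        (\<Sum>i<ns P. weight s i * y' i * y i * relu' (y i * dot (iterate P \<omega> s j r) (sig P)))"
      using h_pos n_pos kappa by (intro mult_left_mono weighted_class_balance) auto
    with rate show "3 * h \<le> h * snr2 / n *
        (\<Sum>i<ns P. weight s i * y' i * y i * relu' (y i * dot (iterate P \<omega> s j r) (sig P)))"
      by (rule order_trans)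
  qed
  then show ?thesis by simp
qed

text \<open>The rate \<open>1/16\<close> is \<open>1/4\<close> from \<open>noise_lower\<close> times
  a weight of at least \<open>1/4\<close>. It also covers the leak \<open>e * (\<kappa> + 2)\<close>
  from the other directions, which keeps the neuron active through the induction.\<close>

lemma rcoef_lower:
  assumes "i < ns P" "r < wd P" and start: "0 \<le> dot (init_weights \<omega> (obs_label \<omega> i) r) (noise \<omega> i)"
    and "t * h \<le> c"
  shows "t * h / 16 \<le> rcoef t (obs_label \<omega> i) r i"
  using assms(4)
proof (induction t)
  case 0
  then show ?case by (simp add: rcoef_def)
next
  case (Suc t)
  let ?j = "obs_label \<omega> i"
  have j: "?j \<in> {1, -1}" using obs_label assms(1) by simp
  have th: "t * h \<le> c" using Suc.prems by (rule step_time_mono[rotated]) simp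
  have IH: "t * h / 16 \<le> rcoef t ?j r i" using Suc.IH[OF th] .
  have "e * (\<kappa> + 2) * (t * h) \<le> 1/16 * (t * h)"
    using e_kappa e h_pos by (intro mult_right_mono) (auto simp: algebra_simps)
  then have "e * (t * h * (\<kappa> + 2)) \<le> t * h / 16" by (simp add: mult_ac)
  then have "0 \<le> dot (iterate P \<omega> t ?j r) (noise \<omega> i)"
    using iterate_noise[OF j assms(1), of t r] start IH by linarith
  then have inc: "rcoef (Suc t) ?j r i = rcoef t ?j r i + lrate P * \<xi>2 i / (n * m) * weight t i"
    using assms(1) j by (auto simp: rcoef_def relu'_def)
  have "h / 4 * (1 / 4) \<le> lrate P * \<xi>2 i / (n * m) * weight t i"
  proof (rule mult_mono)
    have "lrate P * ((sd_noise P)\<^sup>2 * dm P / 4) / (n * m) \<le> lrate P * \<xi>2 i / (n * m)"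
      using noise_lower[OF assms(1)] pos by (intro divide_right_mono mult_left_mono) auto
    then show "h / 4 \<le> lrate P * \<xi>2 i / (n * m)" by (simp add: h_def)
    show "1 / 4 \<le> weight t i" using weight_near_half[OF th assms(1)] p by linarith
  qed (use pos in auto)
  then show ?case using IH inc by (simp add: algebra_simps)
qed

text \<open>Holds already neuron by neuron, index \<open>r\<close> of the true label against index
  \<open>r\<close> of the opposite one. Since \<gamma> is positive for both outputs, a neuron of the
  opposite label has a negative product with the signal patch; only its memorized noise, about
  \<open>2 * \<theta>\<close> at most, opposes the signal \<open>3 * \<theta>\<close>.\<close>

lemma F_out_order:
  assumes t: "t * h \<le> c" "c / 2 \<le> t * h" and i: "i < ns P"
  shows "F_out (dm P) (wd P) (iterate P \<omega> t) (- true_label \<omega> i) (sample P \<omega> i)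
    \<le> F_out (dm P) (wd P) (iterate P \<omega> t) (true_label \<omega> i) (sample P \<omega> i)"
proof -
  define \<theta> where "\<theta> = t * h"
  have \<theta>: "0 \<le> \<theta>" using h_pos by (simp add: \<theta>_def)
  have j: "true_label \<omega> i \<in> {1, -1}" "- true_label \<omega> i \<in> {1, -1}" using true_label[OF i] by auto
  \<comment> \<open>The lower bound on the time enters here: growth must dominate the
    initialization.\<close>
  have e6: "3 * e \<le> \<theta>" using t c_bounds by (simp add: \<theta>_def)
  have "e * (\<kappa> + 4) * \<theta> \<le> 1/96 * \<theta>"
    using e_kappa \<theta> by (intro mult_right_mono) auto
  then have e\<kappa>: "e * (\<theta> * (\<kappa> + 2)) + e * (2 * \<theta>) \<le> 1/96 * \<theta>" by (simp add: algebra_simps)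
  have e0: "0 \<le> e * (\<theta> * (\<kappa> + 2))" "0 \<le> e * (2 * \<theta>)" using e \<theta> kappa by auto
  show ?thesis
    unfolding F_out_def sample_dots
  proof (intro mult_left_mono sum_mono)
    fix r assume "r \<in> {..<wd P}"
    then have r: "r < wd P" by simp
    have right: "\<theta> * 3 - e - e * (2 * \<theta>) \<le> y i * dot (iterate P \<omega> t (true_label \<omega> i) r) (sig P)"
      using iterate_sig[OF j(1), of t r] init_sig[OF j(1) r] gcoef_lower[OF t(1), of "true_label \<omega> i" r] j(1)
      by (auto simp: \<theta>_def abs_le_iff)
    have wrong: "y i * dot (iterate P \<omega> t (- true_label \<omega> i) r) (sig P) \<le> e + e * (2 * \<theta>) - \<theta> * 3"
      using iterate_sig[OF j(2), of t r] init_sig[OF j(2) r] gcoef_lower[OF t(1), of "- true_label \<omega> i" r] j(1)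
      by (auto simp: \<theta>_def abs_le_iff)
    have memo: "dot (iterate P \<omega> t (- true_label \<omega> i) r) (noise \<omega> i) \<le> e + 2 * \<theta> + e * (\<theta> * (\<kappa> + 2))"
      using iterate_noise[OF j(2) i, of t r] init_noise[OF j(2) r i] rcoef_abs_le[OF j(2), of t r i]
      unfolding \<theta>_def by linarith
    show "relu (y i * dot (iterate P \<omega> t (- true_label \<omega> i) r) (sig P)) + relu (dot (iterate P \<omega> t (- true_label \<omega> i) r) (noise \<omega> i))
        \<le> relu (y i * dot (iterate P \<omega> t (true_label \<omega> i) r) (sig P)) + relu (dot (iterate P \<omega> t (true_label \<omega> i) r) (noise \<omega> i))"
      using right wrong memo e6 e\<kappa> e0 e unfolding relu_def by linarith
  qed simp
qed

text \<open>The sign is that of the true label whatever the observed one, so clean and noisy samples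
  are settled together.\<close>

lemma true_label_net_nonneg:
  assumes "t * h \<le> c" "c / 2 \<le> t * h" "i < ns P"
  shows "0 \<le> y i * net_at P \<omega> t i"
  using F_out_order[OF assms] true_label[OF assms(3)] by (auto simp: net_at_def net_def)

section \<open>Sizes and signs at the final time\<close>

lemma gam_eq: "j \<in> {1, -1} \<Longrightarrow> gam P \<omega> t j r = gcoef t j r"
  by (simp add: gam_def decomp_coeffs_eq)

lemma rho_eq: "j \<in> {1, -1} \<Longrightarrow> rho P \<omega> t j r i = rcoef t j r i"
  by (simp add: rho_def decomp_coeffs_eq)

text \<open>\<open>c / 32\<close> is the memorization rate \<open>1/16\<close> at the earliest time
  \<open>c / 2\<close>; \<open>c * \<kappa>\<close> is the signal bound at time \<open>c\<close> and
  exceeds \<open>2 * c\<close>. One pair of constants thus fits both kinds of coefficients.\<close>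

lemma early_stage:
  assumes t: "t * h \<le> c" "c / 2 \<le> t * h"
  shows "\<forall>i<ns P. \<forall>r<wd P. dotp (dm P) (init_weights \<omega> (obs_label \<omega> i) r) (noise \<omega> i) \<ge> 0 \<longrightarrow>
      c / 32 \<le> rho_bar P \<omega> t (obs_label \<omega> i) r i \<and> rho_bar P \<omega> t (obs_label \<omega> i) r i \<le> c * \<kappa>"
    and "\<forall>j\<in>{1, -1}. \<forall>r<wd P. c / 32 \<le> gam P \<omega> t j r \<and> gam P \<omega> t j r \<le> c * \<kappa>"
    and "\<forall>j\<in>{1, -1}. \<forall>r<wd P. \<forall>i<ns P. gam P \<omega> t j r > rho_bar P \<omega> t (obs_label \<omega> i) r i"
    and "\<forall>i\<in>clean_samples P \<omega>. of_int (obs_label \<omega> i) * net_at P \<omega> t i \<ge> 0"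
    and "\<forall>i\<in>noisy_samples P \<omega>. of_int (obs_label \<omega> i) * net_at P \<omega> t i \<le> 0"
proof -
  have th: "0 < t * h" using t c_bounds by linarith
  have rho_bar_le: "rho_bar P \<omega> t (obs_label \<omega> i) r i \<le> 2 * (t * h)" if "i < ns P" for i r
    using rcoef_abs_le[OF obs_label[OF that], of t r i] th
    by (simp add: rho_bar_def rho_eq[OF obs_label[OF that]] abs_le_iff)
  have "c * 2 \<le> c * \<kappa>" using c_bounds kappa by (intro mult_left_mono) auto
  then have up: "2 * (t * h) \<le> c * \<kappa>" using t by linarith
  show "\<forall>i<ns P. \<forall>r<wd P. dotp (dm P) (init_weights \<omega> (obs_label \<omega> i) r) (noise \<omega> i) \<ge> 0 \<longrightarrow>
      c / 32 \<le> rho_bar P \<omega> t (obs_label \<omega> i) r i \<and> rho_bar P \<omega> t (obs_label \<omega> i) r i \<le> c * \<kappa>"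
  proof (intro allI impI conjI)
    fix i r assume i: "i < ns P" and r: "r < wd P"
      and start: "dotp (dm P) (init_weights \<omega> (obs_label \<omega> i) r) (noise \<omega> i) \<ge> 0"
    have "t * h / 16 \<le> rho P \<omega> t (obs_label \<omega> i) r i"
      using rcoef_lower[OF i r start t(1)] by (simp add: rho_eq[OF obs_label[OF i]])
    then show "c / 32 \<le> rho_bar P \<omega> t (obs_label \<omega> i) r i"
      using t th by (simp add: rho_bar_def)
    show "rho_bar P \<omega> t (obs_label \<omega> i) r i \<le> c * \<kappa>"
      using rho_bar_le[OF i, of r] up by linarith
  qed
  show "\<forall>j\<in>{1, -1}. \<forall>r<wd P. c / 32 \<le> gam P \<omega> t j r \<and> gam P \<omega> t j r \<le> c * \<kappa>"
  proof (intro ballI allI impI conjI)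
    fix j :: int and r assume j: "j \<in> {1, -1}"
    show "c / 32 \<le> gam P \<omega> t j r"
      using gcoef_lower[OF t(1), of j r] t c_bounds by (simp add: gam_eq[OF j])
    have "t * h * \<kappa> \<le> c * \<kappa>" using t kappa by (intro mult_right_mono) auto
    then show "gam P \<omega> t j r \<le> c * \<kappa>"
      using gcoef_abs_le[of t j r] by (simp add: gam_eq[OF j])
  qed
  show "\<forall>j\<in>{1, -1}. \<forall>r<wd P. \<forall>i<ns P. gam P \<omega> t j r > rho_bar P \<omega> t (obs_label \<omega> i) r i"
  proof (intro ballI allI impI)
    fix j :: int and r i assume j: "j \<in> {1, -1}" and i: "i < ns P"
    show "gam P \<omega> t j r > rho_bar P \<omega> t (obs_label \<omega> i) r i"
      using gcoef_lower[OF t(1), of j r] rho_bar_le[OF i, of r] th unfolding gam_eq[OF j] by linarith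
  qed
  show "\<forall>i\<in>clean_samples P \<omega>. of_int (obs_label \<omega> i) * net_at P \<omega> t i \<ge> 0"
    using true_label_net_nonneg[OF t] by (auto simp: clean_samples_def)
  show "\<forall>i\<in>noisy_samples P \<omega>. of_int (obs_label \<omega> i) * net_at P \<omega> t i \<le> 0"
  proof
    fix i assume "i \<in> noisy_samples P \<omega>"
    then have i: "i < ns P" "obs_label \<omega> i \<noteq> true_label \<omega> i" by (auto simp: noisy_samples_def)
    then have "y' i = - y i" using true_label[OF i(1)] obs_label[OF i(1)] by auto
    then show "y' i * net_at P \<omega> t i \<le> 0" using true_label_net_nonneg[OF t i(1)] by simp
  qed
qed

end

section \<open>Choice of the constants\<close>

text \<open>With \<open>u = ln (exp 1 + g)\<close> this is the decay of
  \<open>u ^ q / exp u\<close>. It makes the logarithm of the horizon at least 1, so its square only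
  strengthens the bound on the dimension.\<close>

lemma horizon_large:
  fixes a :: real
  assumes "a > 0"
  shows "\<exists>g0. \<forall>g\<ge>g0. exp 1 \<le> a * g / ln (exp 1 + g) ^ q"
proof -
  \<comment> \<open>Chosen so that \<open>exp 1 * (b * (2 * g)) = a * g\<close>, where
    \<open>2 * g\<close> bounds \<open>exp 1 + g\<close>.\<close>
  define b where "b = a / (2 * exp 1)"
  have b: "b > 0" using assms by (simp add: b_def)
  have "((\<lambda>u::real. u ^ q / exp u) \<longlongrightarrow> 0) at_top"
    by (rule tendsto_power_div_exp_0)
  then have "eventually (\<lambda>u. u ^ q / exp u < b) at_top"
    using b by (rule order_tendstoD)
  then obtain u0 where u0: "\<And>u. u \<ge> u0 \<Longrightarrow> u ^ q / exp u < b"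
    by (auto simp: eventually_at_top_linorder)
  show ?thesis
  proof (intro exI allI impI)
    fix g assume g: "g \<ge> max (exp 1) (exp u0)"
    have pos: "exp 1 + g > 0" "g > 0" using g exp_gt_zero[of "1::real"] by linarith+
    have "ln (exp 1 + g) \<ge> 1" using pos by (simp add: ln_ge_iff)
    moreover have "exp u0 \<le> exp 1 + g" using g exp_gt_zero[of "1::real"] by linarith
    then have "ln (exp 1 + g) \<ge> u0" using pos by (simp add: ln_ge_iff)
    ultimately have "ln (exp 1 + g) ^ q < b * (exp 1 + g)" "ln (exp 1 + g) > 0"
      using u0[of "ln (exp 1 + g)"] pos by (simp add: pos_divide_less_eq, linarith)
    then have "ln (exp 1 + g) ^ q > 0" by simp
    have "b * (exp 1 + g) \<le> b * (2 * g)"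
      using g b by (intro mult_left_mono) auto
    with \<open>ln (exp 1 + g) ^ q < b * (exp 1 + g)\<close>
    have "exp 1 * ln (exp 1 + g) ^ q \<le> exp 1 * (b * (2 * g))"
      by (intro mult_left_mono) auto
    also have "\<dots> = a * g" by (simp add: b_def)
    finally have "exp 1 * ln (exp 1 + g) ^ q \<le> a * g" .
    with \<open>ln (exp 1 + g) ^ q > 0\<close> show "exp 1 \<le> a * g / ln (exp 1 + g) ^ q"
      by (simp add: field_simps)
  qed
qed

text \<open>The two bounds on the dimension control noise against noise and, in the noise scale,
  noise against signal; the bound on the signal norm controls the latter in the signal scale; the
  two bounds on \<open>sd_init\<close> control the initialization. Since \<open>e \<le> 1\<close>,
  \<open>C \<ge> 16 / e\<^sup>2\<close> makes both \<open>C * e\<close> and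
  \<open>C * e\<^sup>2\<close> at least 16.\<close>

lemma typical_controlled:
  assumes P: "well_posed P" and cond: "condition_C (12 / p) \<kappa> \<tau>0 \<tau>1 C P" and T: "1 \<le> ln (real (horizon P))"
    and p: "0 < p" "p \<le> 1/4" and e: "0 < e" "6 * e \<le> p / (4 * (\<kappa> + 4))" and eC: "16 / e\<^sup>2 \<le> C"
    and e1: "e \<le> 1" and typical: "typical P p \<omega>"
  shows "controlled_outcome P \<omega> e p \<kappa>"
proof -
  define n m d s s0 \<mu> \<delta> where "n = real (ns P)" and "m = real (wd P)" and "d = real (dm P)"
    and "s = sd_noise P" and "s0 = sd_init P" and "\<mu> = vnorm (dm P) (sig P)" and "\<delta> = conf P"
  note defs = n_def m_def d_def s_def s0_def \<mu>_def \<delta>_def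
  have pos: "n \<ge> 1" "m \<ge> 1" "d \<ge> 1" "s > 0" "s0 > 0" "0 < \<delta>" "\<delta> < 1" and P': "0 < ns P" "0 < wd P" "0 < dm P" "0 < lrate P"
    using P by (auto simp: well_posed_def defs)
  have "\<mu> \<noteq> 0" using P by (auto simp: well_posed_def \<mu>_def L2_set_eq_0_iff)
  then have \<mu>: "\<mu> > 0" by (simp add: \<mu>_def less_le)
  have "e\<^sup>2 \<le> 1" "e\<^sup>2 > 0" using e e1 by (auto intro: power_le_one)
  then have "16 \<le> 16 / e\<^sup>2" by (simp add: field_simps)
  moreover have eC1: "16 / e \<le> C"
  proof -
    have "16 / e \<le> 16 / e\<^sup>2" using e e1 by (simp add: field_simps power2_eq_square)
    with eC show ?thesis by simp
  qed
  ultimately have C: "C \<ge> 16" "C * e \<ge> 16" "C * e\<^sup>2 \<ge> 16"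
    using eC e \<open>16 \<le> 16 / e\<^sup>2\<close> by (linarith, simp_all add: pos_divide_le_eq)

  define L L' Lm where "L = ln (n / \<delta>)" and "L' = ln (n * m / \<delta>)" and "Lm = ln (m / \<delta>)"
  have "1 \<le> n / \<delta>" "n / \<delta> \<le> n * m / \<delta>" "1 \<le> m / \<delta>"
    using pos by (auto simp: field_simps)
  then have L: "0 \<le> L" "L \<le> L'" "0 \<le> L'" "0 \<le> Lm"
    by (auto simp: L_def L'_def Lm_def)

  have cond': "d \<ge> C * max (n\<^sup>2 * L' * (ln (horizon P))\<^sup>2) (n * \<mu> / s * sqrt L)" "\<mu>\<^sup>2 \<ge> C * s\<^sup>2 * L"
      "s0 \<le> 1 / C * min (sqrt n / (s * d)) (1 / (\<mu> * sqrt Lm))"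
      "12 / p \<le> n * (SNR P)\<^sup>2" "n * (SNR P)\<^sup>2 \<le> \<kappa>"
    using cond by (simp_all add: condition_C_def Let_def defs L_def L'_def Lm_def)
  have "1 \<le> (ln (horizon P))\<^sup>2" using T by simp
  then have "n\<^sup>2 * L' * 1 \<le> n\<^sup>2 * L' * (ln (horizon P))\<^sup>2"
    using L by (intro mult_left_mono) auto
  then have "C * (n\<^sup>2 * L') \<le> C * max (n\<^sup>2 * L' * (ln (horizon P))\<^sup>2) (n * \<mu> / s * sqrt L)"
    using C by (intro mult_left_mono) auto
  then have d1: "C * (n\<^sup>2 * L') \<le> d" using cond'(1) by linarith
  have "C * (n * \<mu> / s * sqrt L) \<le> C * max (n\<^sup>2 * L' * (ln (horizon P))\<^sup>2) (n * \<mu> / s * sqrt L)"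
    using C by (intro mult_left_mono) auto
  then have d2: "C * (n * \<mu> / s * sqrt L) \<le> d" using cond'(1) by linarith
  have "1 / C * min (sqrt n / (s * d)) (1 / (\<mu> * sqrt Lm)) \<le> 1 / C * (sqrt n / (s * d))"
      "1 / C * min (sqrt n / (s * d)) (1 / (\<mu> * sqrt Lm)) \<le> 1 / C * (1 / (\<mu> * sqrt Lm))"
    using C by (intro mult_left_mono; simp)+
  then have s01: "s0 \<le> 1 / C * (sqrt n / (s * d))" and s02: "s0 \<le> 1 / C * (1 / (\<mu> * sqrt Lm))"
    using cond'(3) by linarith+

  have noise: "s\<^sup>2 * d / 4 \<le> (vnorm (dm P) (noise \<omega> i))\<^sup>2" "(vnorm (dm P) (noise \<omega> i))\<^sup>2 \<le> 2 * (s\<^sup>2 * d)"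
    if "i < ns P" for i
    using typical that by (auto simp: typical_def Let_def defs)
  have init: "\<forall>j\<in>{1, -1}. \<forall>r<wd P. \<bar>dotp (dm P) (init_weights \<omega> j r) (sig P)\<bar> \<le> s0 * \<mu> * sqrt (2 * Lm)"
      "\<forall>j\<in>{1, -1}. \<forall>r<wd P. \<forall>i<ns P.
        \<bar>dotp (dm P) (init_weights \<omega> j r) (noise \<omega> i)\<bar> \<le> s0 * vnorm (dm P) (noise \<omega> i) * sqrt (2 * L')"
    using typical unfolding typical_def Let_def defs Lm_def L'_def by - (elim conjE, assumption)+
  have cross: "s * V * sqrt (4 * L) \<le> e / n * V\<^sup>2" if V: "s\<^sup>2 * d / 4 \<le> V\<^sup>2" "0 \<le> V" for V
  proof -
    have "(n * (s * sqrt (4 * L)))\<^sup>2 = 4 * s\<^sup>2 * n\<^sup>2 * L"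
      using L by (simp add: power_mult_distrib)
    also have "\<dots> \<le> C * e\<^sup>2 / 4 * s\<^sup>2 * n\<^sup>2 * L'"
      using C L by (intro mult_mono) auto
    also have "\<dots> = e\<^sup>2 * (s\<^sup>2 * (C * (n\<^sup>2 * L')) / 4)" by simp
    also have "\<dots> \<le> e\<^sup>2 * (s\<^sup>2 * d / 4)"
      using d1 by (intro mult_left_mono divide_right_mono) auto
    also have "\<dots> \<le> e\<^sup>2 * V\<^sup>2" using V by (intro mult_left_mono) auto
    finally have "(n * (s * sqrt (4 * L)))\<^sup>2 \<le> (e * V)\<^sup>2" by (simp add: power_mult_distrib)
    then have "n * (s * sqrt (4 * L)) \<le> e * V"
      by (rule power2_le_imp_le) (use e V in auto)
    then have "n * (s * sqrt (4 * L)) * V \<le> e * V * V" using V by (intro mult_right_mono)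
    then show ?thesis using pos by (simp add: field_simps power2_eq_square)
  qed
  have nsig: "s * \<mu> * sqrt (2 * L) \<le> e * \<mu>\<^sup>2"
  proof -
    have "(s * sqrt (2 * L))\<^sup>2 = 2 * (s\<^sup>2 * L)" using L by (simp add: power_mult_distrib)
    also have "\<dots> \<le> C * e\<^sup>2 * (s\<^sup>2 * L)" using C L by (intro mult_right_mono) auto
    also have "\<dots> = e\<^sup>2 * (C * s\<^sup>2 * L)" by simp
    also have "\<dots> \<le> e\<^sup>2 * \<mu>\<^sup>2" using cond'(2) by (intro mult_left_mono) auto
    finally have "(s * sqrt (2 * L))\<^sup>2 \<le> (e * \<mu>)\<^sup>2" by (simp add: power_mult_distrib)
    then have "s * sqrt (2 * L) \<le> e * \<mu>" by (rule power2_le_imp_le) (use e \<mu> in auto)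
    then have "s * sqrt (2 * L) * \<mu> \<le> e * \<mu> * \<mu>" using \<mu> by (intro mult_right_mono) auto
    then show ?thesis by (simp add: power2_eq_square mult_ac)
  qed
  have nsig': "s * \<mu> * sqrt (2 * L) \<le> e / n * V\<^sup>2" if V: "s\<^sup>2 * d / 4 \<le> V\<^sup>2" for V
  proof -
    have "sqrt (2 * L) \<le> sqrt (4\<^sup>2 * L)" using L by (intro real_sqrt_le_mono mult_right_mono) auto
    then have "sqrt (2 * L) \<le> 4 * sqrt L" by (simp add: real_sqrt_mult)
    then have "s * \<mu> * sqrt (2 * L) \<le> s * \<mu> * (4 * sqrt L)"
      using pos \<mu> by (intro mult_left_mono) auto
    also have "\<dots> = 16 / 4 * s * \<mu> * sqrt L" by simp
    also have "\<dots> \<le> C * e / 4 * s * \<mu> * sqrt L"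
      using C pos \<mu> L by (intro mult_right_mono) auto
    also have "\<dots> = e / n * (s\<^sup>2 * (C * (n * \<mu> / s * sqrt L)) / 4)"
      using pos by (simp add: power2_eq_square)
    also have "\<dots> \<le> e / n * (s\<^sup>2 * d / 4)"
      using d2 e pos by (intro mult_left_mono divide_right_mono) auto
    also have "\<dots> \<le> e / n * V\<^sup>2" using V e pos by (intro mult_left_mono) auto
    finally show ?thesis .
  qed
  have isig: "s0 * \<mu> * sqrt (2 * Lm) \<le> e"
  \<comment> \<open>Separates the case in which \<open>sqrt Lm\<close> cannot be cancelled.\<close>
  proof (cases "Lm = 0")
    case True
    then show ?thesis using e by simp
  next
    case False
    then have Lm: "Lm > 0" using L by simp
    have "s0 * (\<mu> * sqrt (2 * Lm)) \<le> 1 / C * (1 / (\<mu> * sqrt Lm)) * (\<mu> * sqrt (2 * Lm))"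
      using s02 \<mu> L by (intro mult_right_mono) auto
    also have "\<dots> = sqrt 2 / C" using \<mu> Lm C by (simp add: real_sqrt_mult)
    also have "\<dots> \<le> 2 / C" using C sqrt_le_D[of 2 2] by (intro divide_right_mono) (auto intro: real_le_lsqrt)
    also have "\<dots> \<le> e" using C by (simp add: field_simps)
    finally show ?thesis by (simp add: mult.assoc)
  qed
  have inoise: "s0 * V * sqrt (2 * L') \<le> e" if V: "V\<^sup>2 \<le> 2 * (s\<^sup>2 * d)" "0 \<le> V" for V
  proof -
    \<comment> \<open>The first bound on \<open>d\<close> gives \<open>n * L' \<le> d\<close>, after
      which the factor \<open>sqrt n / (s * d)\<close> in the bound on \<open>s0\<close> cancels
      against the noise norm and the logarithm.\<close>
    have "n * L' * 1 \<le> n * L' * (C * n)"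
      using C pos L mult_mono[of 1 C 1 n] by (intro mult_left_mono) auto
    then have nL: "n * L' \<le> d" using d1 by (simp add: power2_eq_square mult_ac)
    have "(sqrt n * V * sqrt (2 * L'))\<^sup>2 = n * L' * (2 * V\<^sup>2)"
      using pos L by (simp add: power_mult_distrib)
    also have "\<dots> \<le> d * (4 * (s\<^sup>2 * d))"
      using nL V L pos by (intro mult_mono[OF nL]) (auto simp: mult.commute)
    also have "\<dots> = (2 * (s * d))\<^sup>2" by (simp add: power2_eq_square)
    finally have le: "sqrt n * V * sqrt (2 * L') \<le> 2 * (s * d)"
      by (rule power2_le_imp_le) (use pos in auto)
    have "s0 * (V * sqrt (2 * L')) \<le> 1 / C * (sqrt n / (s * d)) * (V * sqrt (2 * L'))"
      using s01 V L by (intro mult_right_mono) auto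
    also have "\<dots> = (sqrt n * V * sqrt (2 * L')) / (C * (s * d))" by simp
    also have "\<dots> \<le> (2 * (s * d)) / (C * (s * d))"
      using le C pos by (intro divide_right_mono) auto
    also have "\<dots> = 2 / C" using pos by simp
    also have "\<dots> \<le> e" using C by (simp add: field_simps)
    finally show ?thesis by (simp add: mult.assoc)
  qed

  show ?thesis
  proof
    show "0 < ns P" "0 < wd P" "0 < dm P" "vnorm (dm P) (sig P) > 0" "0 < sd_noise P" "0 < lrate P"
      using P' \<mu> pos by (auto simp: defs)
    show "12 / p \<le> real (ns P) * (SNR P)\<^sup>2" "real (ns P) * (SNR P)\<^sup>2 \<le> \<kappa>"
      using cond' by (auto simp: defs)
    show "0 < p" "p \<le> 1/4" "0 < e" "6 * e \<le> p / (4 * (\<kappa> + 4))" by fact+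
    show "true_label \<omega> i \<in> {1, -1}" "obs_label \<omega> i \<in> {1, -1}" if "i < ns P" for i
      using typical that by (simp_all add: typical_def Let_def)
    show "real (ns P) * p \<le> (\<Sum>i<ns P. class_margin q (true_label \<omega> i, obs_label \<omega> i))" if "q \<in> {1, -1}" for q
      using typical that by (auto simp: typical_def Let_def)
    show "(sd_noise P)\<^sup>2 * dm P / 4 \<le> (vnorm (dm P) (noise \<omega> i))\<^sup>2"
        "(vnorm (dm P) (noise \<omega> i))\<^sup>2 \<le> 2 * ((sd_noise P)\<^sup>2 * dm P)" if "i < ns P" for i
      using noise[OF that] by (auto simp: defs)
    show "\<bar>dotp (dm P) (noise \<omega> i') (noise \<omega> i)\<bar> \<le> e / ns P * (vnorm (dm P) (noise \<omega> i))\<^sup>2"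
      if "i < ns P" "i' < ns P" "i \<noteq> i'" for i i'
    proof -
      have "\<bar>dotp (dm P) (noise \<omega> i') (noise \<omega> i)\<bar> \<le> s * vnorm (dm P) (noise \<omega> i) * sqrt (4 * L)"
        using typical that by (simp add: typical_def Let_def defs L_def)
      with cross[OF noise(1)[OF that(1)]] show ?thesis by (simp add: n_def)
    qed
    show "\<bar>dotp (dm P) (noise \<omega> i) (sig P)\<bar> \<le> e * (vnorm (dm P) (sig P))\<^sup>2"
        "\<bar>dotp (dm P) (noise \<omega> i) (sig P)\<bar> \<le> e / ns P * (vnorm (dm P) (noise \<omega> i))\<^sup>2" if "i < ns P" for i
    proof -
      have le: "\<bar>dotp (dm P) (noise \<omega> i) (sig P)\<bar> \<le> s * \<mu> * sqrt (2 * L)"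
        using typical that by (simp add: typical_def Let_def defs L_def)
      from le nsig show "\<bar>dotp (dm P) (noise \<omega> i) (sig P)\<bar> \<le> e * (vnorm (dm P) (sig P))\<^sup>2"
        by (simp add: \<mu>_def)
      from le nsig'[OF noise(1)[OF that]]
      show "\<bar>dotp (dm P) (noise \<omega> i) (sig P)\<bar> \<le> e / ns P * (vnorm (dm P) (noise \<omega> i))\<^sup>2"
        by (simp add: n_def)
    qed
    show "\<bar>dotp (dm P) (init_weights \<omega> j r) (sig P)\<bar> \<le> e" if "j \<in> {1, -1}" "r < wd P" for j r
    proof -
      have "\<bar>dotp (dm P) (init_weights \<omega> j r) (sig P)\<bar> \<le> s0 * \<mu> * sqrt (2 * Lm)"
        using bspec[OF init(1) that(1)] that(2) by blast
      with isig show ?thesis by linarith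
    qed
    show "\<bar>dotp (dm P) (init_weights \<omega> j r) (noise \<omega> i)\<bar> \<le> e" if "j \<in> {1, -1}" "r < wd P" "i < ns P" for j r i
    proof -
      have "\<bar>dotp (dm P) (init_weights \<omega> j r) (noise \<omega> i)\<bar> \<le> s0 * vnorm (dm P) (noise \<omega> i) * sqrt (2 * L')"
        using bspec[OF init(2) that(1)] that(2,3) by blast
      with inoise[OF noise(2)[OF that(3)]] show ?thesis by simp
    qed
  qed
qed

definition early_alignment :: "setting \<Rightarrow> outcome \<Rightarrow> real \<Rightarrow> real \<Rightarrow> real \<Rightarrow> real \<Rightarrow> nat \<Rightarrow> bool" where
  "early_alignment P \<omega> c1 c2 b1 b2 T1 \<longleftrightarrow>
     c1 * time_unit P \<le> real T1 \<and> real T1 \<le> c2 * time_unit P \<and>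
     (\<forall>i<ns P. \<forall>r<wd P.
        dotp (dm P) (init_weights \<omega> (obs_label \<omega> i) r) (noise \<omega> i) \<ge> 0 \<longrightarrow>
        b1 \<le> rho_bar P \<omega> T1 (obs_label \<omega> i) r i \<and>
        rho_bar P \<omega> T1 (obs_label \<omega> i) r i \<le> b2) \<and>
     (\<forall>j\<in>{1, -1}. \<forall>r<wd P. b1 \<le> gam P \<omega> T1 j r \<and> gam P \<omega> T1 j r \<le> b2) \<and>
     (\<forall>j\<in>{1, -1}. \<forall>r<wd P. \<forall>i<ns P. gam P \<omega> T1 j r > rho_bar P \<omega> T1 (obs_label \<omega> i) r i) \<and>
     (\<forall>i\<in>clean_samples P \<omega>. of_int (obs_label \<omega> i) * net_at P \<omega> T1 i \<ge> 0) \<and>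
     (\<forall>i\<in>noisy_samples P \<omega>. of_int (obs_label \<omega> i) * net_at P \<omega> T1 i \<le> 0)"

text \<open>The lower bounds on \<open>C\<close> serve different ends: \<open>16 / e\<^sup>2\<close>
  the cross terms, \<open>2 / p\<^sup>2\<close> the margin tail, \<open>2 / c\<close> the rounding
  of the time, 8 the norm tails, \<open>\<bar>g0\<bar> * \<epsilon>0\<close> the horizon.\<close>

lemma early_stage_probable:
  assumes \<tau>1: "\<tau>1 < 1/2"
  defines "p \<equiv> (1 - 2 * \<tau>1) / 4"
  assumes P: "well_posed P" and \<epsilon>0: "acc P \<le> \<epsilon>0" and hor: "horizon_ok a1 a2 q P"
    and \<kappa>: "12 / p \<le> \<kappa>" and cond: "condition_C (12 / p) \<kappa> \<tau>0 \<tau>1 C P"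
    and g0: "\<And>g. g \<ge> g0 \<Longrightarrow> exp 1 \<le> a1 * g / ln (exp 1 + g) ^ q"
  defines "c \<equiv> p / (4 * (\<kappa> + 4))"
  defines "e \<equiv> c / 6"
  assumes p: "0 < p" "p \<le> 1/4" and C: "C \<ge> 16 / e\<^sup>2" "C \<ge> 2 / p\<^sup>2" "C \<ge> 2 / c" "C \<ge> 8" "C \<ge> \<bar>g0\<bar> * \<epsilon>0"
  shows "\<exists>A\<in>sets (training_law P).
          measure (training_law P) A \<ge> 1 - 16 * conf P \<and>
          (\<forall>\<omega>\<in>A. \<exists>T1::nat. early_alignment P \<omega> (c / 2) c (c / 32) (c * \<kappa>) T1)"
proof -
  define n m d s \<delta> where "n = real (ns P)" and "m = real (wd P)" and "d = real (dm P)"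
    and "s = sd_noise P" and "\<delta> = conf P"
  note defs = n_def m_def d_def s_def \<delta>_def
  have pos: "n \<ge> 1" "m \<ge> 1" "d \<ge> 1" "s > 0" "0 < \<delta>" "\<delta> < 1" "lrate P > 0" "acc P > 0"
    using P by (auto simp: well_posed_def defs)
  have "0 < 12 / p" using p by simp
  then have \<kappa>0: "\<kappa> > 0" using \<kappa> by linarith
  then have c: "0 < c" "c \<le> 1" using p by (auto simp: c_def field_simps)
  have e: "0 < e" "e \<le> 1" "6 * e \<le> p / (4 * (\<kappa> + 4))"
    unfolding c_def[symmetric] using c by (auto simp: e_def)

  \<comment> \<open>The second bound on the learning rate, with \<open>m \<ge> 1\<close>, makes the
    time unit at least \<open>C\<close>.\<close>
  have "lrate P \<le> 1 / C * min (n\<^sup>2 * m * sqrt (ln (n / \<delta>)) / (s\<^sup>2 * d powr (3/2))) (n / (s\<^sup>2 * d))"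
    using cond by (simp add: condition_C_def Let_def defs)
  also have "\<dots> \<le> 1 / C * (n / (s\<^sup>2 * d))" using C by (intro mult_left_mono) auto
  finally have "C * (lrate P * s\<^sup>2 * d) \<le> n"
    using C pos by (simp add: field_simps)
  moreover have "n * 1 \<le> n * m" using pos by (intro mult_left_mono) auto
  ultimately have "C * (lrate P * s\<^sup>2 * d) \<le> n * m" by linarith
  then have TU: "C \<le> time_unit P"
    using pos by (simp add: time_unit_def defs[symmetric] field_simps)

  have "\<bar>g0\<bar> * acc P \<le> \<bar>g0\<bar> * \<epsilon>0" using \<epsilon>0 by (intro mult_left_mono) auto
  then have "\<bar>g0\<bar> * acc P \<le> time_unit P" using C TU by linarith
  moreover have "g0 * acc P \<le> \<bar>g0\<bar> * acc P" using pos by (intro mult_right_mono) auto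
  ultimately have "g0 * acc P \<le> time_unit P" by linarith
  then have "g0 \<le> time_unit P / acc P" using pos by (simp add: pos_le_divide_eq)
  from g0[OF this] hor have hz: "exp 1 \<le> real (horizon P)"
    unfolding horizon_ok_def soft_Theta_def by linarith
  then have T: "1 \<le> ln (real (horizon P))"
    using less_le_trans[OF exp_gt_zero hz] by (simp add: ln_ge_iff)

  have ln0: "0 \<le> ln (n / \<delta>)" "ln (n / \<delta>) \<le> ln (n * m / \<delta>)" "ln (1 / \<delta>) \<le> ln (m / \<delta>)" "0 \<le> ln (1 / \<delta>)"
    using pos by (auto simp: field_simps)
  have "8 * (1 * ln (n / \<delta>) * 1) \<le> C * (n\<^sup>2 * ln (n * m / \<delta>) * (ln (real (horizon P)))\<^sup>2)"
  proof (intro mult_mono)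
    have "0 \<le> ln (n * m / \<delta>)" using ln0 by linarith
    then show "0 \<le> n\<^sup>2 * ln (n * m / \<delta>)" by simp
    show "1 \<le> n\<^sup>2" "1 \<le> (ln (real (horizon P)))\<^sup>2" using pos T by simp_all
  qed (use C ln0 in auto)
  also have "\<dots> \<le> C * max (n\<^sup>2 * ln (n * m / \<delta>) * (ln (real (horizon P)))\<^sup>2)
      (n * vnorm (dm P) (sig P) / s * sqrt (ln (n / \<delta>)))"
    using C by (intro mult_left_mono) auto
  also have "\<dots> \<le> d"
    using cond by (simp add: condition_C_def Let_def defs)
  finally have dim: "ln (real (ns P) / conf P) \<le> real (dm P) / 8"
    by (simp add: defs)

  have "2 / p\<^sup>2 * ln (1 / \<delta>) \<le> C * ln (m / \<delta>)"
    using C ln0 by (intro mult_mono) auto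
  also have "\<dots> \<le> n"
    using cond by (simp add: condition_C_def Let_def defs)
  finally have num: "ln (1 / conf P) \<le> real (ns P) * p\<^sup>2 / 2"
    using p by (simp add: defs field_simps)

  have flips: "flip_pos P \<le> \<tau>1" "flip_neg P \<le> \<tau>1"
    using cond by (auto simp: condition_C_def Let_def)
  have "holds_with_failure (training_law P) (16 * conf P) (typical P p)"
    using typical_probable[OF P flips \<tau>1 dim] num by (simp add: p_def)
  then obtain A where A: "A \<in> sets (training_law P)" "1 - 16 * conf P \<le> measure (training_law P) A"
      "\<forall>\<omega>\<in>A. typical P p \<omega>"
    unfolding holds_with_failure_def by blast

  \<comment> \<open>Rounding down loses at most 1, hence at most half of a quantity that is at least
    2.\<close>
  define T1 where "T1 = nat \<lfloor>c * time_unit P\<rfloor>"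
  have "c * (2 / c) \<le> c * time_unit P" using C TU c by (intro mult_left_mono) auto
  then have cT: "2 \<le> c * time_unit P" using c by simp
  then have T1: "real T1 \<le> c * time_unit P" "c / 2 * time_unit P \<le> real T1"
    unfolding T1_def by linarith+
  show ?thesis
  proof (intro bexI[OF _ A(1)] conjI[OF A(2)] ballI)
    fix \<omega> assume "\<omega> \<in> A"
    then interpret good: controlled_outcome P \<omega> e p \<kappa>
      using typical_controlled[OF P cond T p e(1,3) C(1) e(2)] A(3) by blast
    have TU0: "time_unit P > 0" using TU C by linarith
    have c_eq: "controlled_outcome.c p \<kappa> = c" by (simp only: c_def good.c_def)
    show "\<exists>T1. early_alignment P \<omega> (c / 2) c (c / 32) (c * \<kappa>) T1"
      using good.early_stage[of T1] T1 TU0 unfolding early_alignment_def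
      by (intro exI[of _ T1]) (simp add: good.h_time_unit c_eq field_simps)
  qed
qed

theorem theorem4p1:
  fixes \<tau>0 \<tau>1 :: real
  assumes "0 < \<tau>0" and "\<tau>0 \<le> \<tau>1" and "\<tau>1 < 1/2"
  shows
    "\<exists>\<kappa>0>0. \<forall>\<kappa>1\<ge>\<kappa>0.
     \<exists>K>0. \<exists>c1>0. \<exists>c2>0. \<exists>b1>0. \<exists>b2>0.
     \<forall>a1>0. \<forall>a2>0. \<forall>p. \<forall>\<epsilon>0>0.
     \<exists>C>0. \<forall>P. well_posed P \<and> acc P \<le> \<epsilon>0 \<and> horizon_ok a1 a2 p P \<and> condition_C \<kappa>0 \<kappa>1 \<tau>0 \<tau>1 C P \<longrightarrow>
       (\<exists>A\<in>sets (training_law P).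
          measure (training_law P) A \<ge> 1 - K * conf P \<and>
          (\<forall>\<omega>\<in>A. \<exists>T1::nat.
             c1 * time_unit P \<le> real T1 \<and> real T1 \<le> c2 * time_unit P \<and>
             (\<forall>i<ns P. \<forall>r<wd P.
                dotp (dm P) (init_weights \<omega> (obs_label \<omega> i) r) (noise \<omega> i) \<ge> 0 \<longrightarrow>
                b1 \<le> rho_bar P \<omega> T1 (obs_label \<omega> i) r i \<and>
                rho_bar P \<omega> T1 (obs_label \<omega> i) r i \<le> b2) \<and>
             (\<forall>j\<in>{1, -1}. \<forall>r<wd P. b1 \<le> gam P \<omega> T1 j r \<and> gam P \<omega> T1 j r \<le> b2) \<and>
             (\<forall>j\<in>{1, -1}. \<forall>r<wd P. \<forall>i<ns P. gam P \<omega> T1 j r > rho_bar P \<omega> T1 (obs_label \<omega> i) r i) \<and>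
             (\<forall>i\<in>clean_samples P \<omega>. of_int (obs_label \<omega> i) * net_at P \<omega> T1 i \<ge> 0) \<and>
             (\<forall>i\<in>noisy_samples P \<omega>. of_int (obs_label \<omega> i) * net_at P \<omega> T1 i \<le> 0)))"
proof -
  define p where "p = (1 - 2 * \<tau>1) / 4"
  have p: "0 < p" "p \<le> 1/4" using assms by (auto simp: p_def)
  have constants: "\<exists>K>0. \<exists>c1>0. \<exists>c2>0. \<exists>b1>0. \<exists>b2>0. \<forall>a1>0. \<forall>a2>0. \<forall>q. \<forall>\<epsilon>0>0. \<exists>C>0. \<forall>P.
      well_posed P \<and> acc P \<le> \<epsilon>0 \<and> horizon_ok a1 a2 q P \<and> condition_C (12 / p) \<kappa> \<tau>0 \<tau>1 C P \<longrightarrow>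
      (\<exists>A\<in>sets (training_law P). measure (training_law P) A \<ge> 1 - K * conf P \<and>
        (\<forall>\<omega>\<in>A. \<exists>T1. early_alignment P \<omega> c1 c2 b1 b2 T1))"
    if \<kappa>: "12 / p \<le> \<kappa>" for \<kappa>
  proof -
    have "0 < 12 / p" using p by simp
    with \<kappa> have \<kappa>0: "\<kappa> > 0" by linarith
    define c where "c = p / (4 * (\<kappa> + 4))"
    have c: "0 < c" using p \<kappa>0 by (simp add: c_def)
    \<comment> \<open>Only \<open>C\<close> depends on the horizon constants and on
      \<open>\<epsilon>0\<close>; the other constants depend on \<open>\<tau>1\<close> and
      \<open>\<kappa>\<close> alone.\<close>
    have "\<exists>C>0. \<forall>P. well_posed P \<and> acc P \<le> \<epsilon>0 \<and> horizon_ok a1 a2 q P \<and>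
        condition_C (12 / p) \<kappa> \<tau>0 \<tau>1 C P \<longrightarrow>
      (\<exists>A\<in>sets (training_law P). measure (training_law P) A \<ge> 1 - 16 * conf P \<and>
        (\<forall>\<omega>\<in>A. \<exists>T1. early_alignment P \<omega> (c / 2) c (c / 32) (c * \<kappa>) T1))"
      if a1: "a1 > 0" and \<epsilon>0: "\<epsilon>0 > 0" for a1 a2 \<epsilon>0 :: real and q
    proof -
      obtain g0 where g0: "\<And>g. g \<ge> g0 \<Longrightarrow> exp 1 \<le> a1 * g / ln (exp 1 + g) ^ q"
        using horizon_large[OF a1] by blast
      \<comment> \<open>A sum of nonnegative requirements dominates each of them.\<close>
      define C where "C = 16 / (c / 6)\<^sup>2 + 2 / p\<^sup>2 + 2 / c + 8 + \<bar>g0\<bar> * \<epsilon>0"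
      have "0 \<le> 16 / (c / 6)\<^sup>2" "0 \<le> 2 / p\<^sup>2" "0 \<le> 2 / c" "0 \<le> \<bar>g0\<bar> * \<epsilon>0"
        using c \<epsilon>0 by auto
      then have C: "16 / (c / 6)\<^sup>2 \<le> C" "2 / p\<^sup>2 \<le> C" "2 / c \<le> C" "8 \<le> C" "\<bar>g0\<bar> * \<epsilon>0 \<le> C"
        unfolding C_def by linarith+
      show ?thesis
      proof (intro exI[of _ C] conjI allI impI)
        show "C > 0" using C by linarith
        fix P assume H: "well_posed P \<and> acc P \<le> \<epsilon>0 \<and> horizon_ok a1 a2 q P \<and>
          condition_C (12 / p) \<kappa> \<tau>0 \<tau>1 C P"
        show "\<exists>A\<in>sets (training_law P). measure (training_law P) A \<ge> 1 - 16 * conf P \<and>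
            (\<forall>\<omega>\<in>A. \<exists>T1. early_alignment P \<omega> (c / 2) c (c / 32) (c * \<kappa>) T1)"
          using early_stage_probable[OF assms(3), of P \<epsilon>0 a1 a2 q \<kappa> \<tau>0 C g0,
              folded p_def, folded c_def, OF _ _ _ \<kappa> _ g0 p C] H by simp
      qed
    qed
    note main = this
    have pos: "c / 2 > 0" "c / 32 > 0" "c * \<kappa> > 0" "(16::real) > 0"
      using c \<kappa>0 by auto
    show ?thesis
      by (rule exI[of _ 16], rule conjI[OF pos(4)], rule exI[of _ "c / 2"], rule conjI[OF pos(1)],
          rule exI[of _ c], rule conjI[OF c], rule exI[of _ "c / 32"], rule conjI[OF pos(2)],
          rule exI[of _ "c * \<kappa>"], rule conjI[OF pos(3)], intro allI impI, rule main)
  qed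
  have "12 / p > 0" using p by simp
  then show ?thesis
    by (rule exI[of _ "12 / p", OF conjI], intro allI impI) (rule constants[unfolded early_alignment_def])
qed

end
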